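(* Suppose there is a square $S_0\subseteq S$ with constant (not depending on $n$) side length $s_0>0$ such that $h(u,v)=d(u,v)$ whenever $u\in S_0$ or $v\in S_0$. Then there is a constant $D_2=D_2(\alpha,c_1,c_2,\epsilon_1,\epsilon_2,s_0)>0$ such that $\mathrm{var}(MST_n)\geq D_2 n^{1-\alpha}$ for all $n$ large.
   Context: $S$ is the unit square in $\mathbb{R}^2$ and $d(x,y)$ is the Euclidean distance. $f$ is a probability density on $S$ with $\epsilon_1 \leq \inf_{x\in S} f(x) \leq \sup_{x \in S} f(x) \leq \epsilon_2$ for constants $0<\epsilon_1\leq\epsilon_2<\infty$; $X_1,X_2,\ldots$ are i.i.d. with density $f$. $h:S\times S\to[0,\infty)$ is a deterministic measurable function with $c_1 d(x,y)\leq h(x,y)=h(y,x)\leq c_2 d(x,y)$ for all $x,y\in S$, for some positive constants $c_1,c_2$. $\alpha>0$ is a constant. $K_n$ is the complete graph on the nodes $X_1,\ldots,X_n$, the edge $(X_i,X_j)$ having weight $(h(X_i,X_j))^{\alpha}$. $MST_n$ is the minimum, over all spanning trees of $K_n$, of the sum of the weights of the edges of the tree. *)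

theory Defs
  imports "HOL-Probability.Probability"
begin

definition unit_square :: "(real^2) set" where
  "unit_square = cbox 0 1"

text \<open>Closed squares of arbitrary position and orientation; \<open>u\<close> and \<open>v\<close> span the two sides at the
  corner \<open>a\<close>.\<close>

definition is_square :: "(real^2) set \<Rightarrow> real \<Rightarrow> bool" where
  "is_square Q s \<longleftrightarrow> s > 0 \<and>
     (\<exists>a u v. norm u = s \<and> norm v = s \<and> u \<bullet> v = 0 \<and>
        Q = {a + x *\<^sub>R u + y *\<^sub>R v | x y. x \<in> {0..1} \<and> y \<in> {0..1}})"

definition admissible_weight :: "real \<Rightarrow> real \<Rightarrow> (real^2 \<Rightarrow> real^2 \<Rightarrow> real) \<Rightarrow> bool" where
  "admissible_weight c1 c2 h \<longleftrightarrow>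
     (\<lambda>(x, y). h x y) \<in> borel_measurable
        (restrict_space borel unit_square \<Otimes>\<^sub>M restrict_space borel unit_square) \<and>
     (\<forall>x\<in>unit_square. \<forall>y\<in>unit_square.
        0 \<le> h x y \<and> h x y = h y x \<and> c1 * dist x y \<le> h x y \<and> h x y \<le> c2 * dist x y)"

text \<open>The variables map into the space \<open>restrict_space lborel unit_square\<close>, so every sample point
  (not just almost every one) lies in the unit square. This matters because the weight function is
  unconstrained, and possibly not measurable, elsewhere. That \<open>f\<close> is measurable on the square with
  integral 1 is part of \<open>distributed\<close>. The sequence starts at index 1.\<close>

definition (in prob_space) iid_density :: "(real^2 \<Rightarrow> real) \<Rightarrow> (nat \<Rightarrow> 'a \<Rightarrow> real^2) \<Rightarrow> bool" where
  "iid_density f X \<longleftrightarrow>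
     indep_vars (\<lambda>_. restrict_space lborel unit_square) X {1..} \<and>
     (\<forall>i\<ge>1. distributed M (restrict_space lborel unit_square) (X i) (\<lambda>x. ennreal (f x)))"

text \<open>Undirected simple graphs on a vertex set \<open>V\<close> are given by sets of two-element subsets of
  \<open>V\<close>.\<close>

definition complete_edges :: "'v set \<Rightarrow> 'v set set" where
  "complete_edges V = {e. e \<subseteq> V \<and> card e = 2}"

definition edges_connected :: "'v set \<Rightarrow> 'v set set \<Rightarrow> bool" where
  "edges_connected V T \<longleftrightarrow> (\<forall>u\<in>V. \<forall>v\<in>V. (u, v) \<in> {(a, b). {a, b} \<in> T}\<^sup>*)"

definition is_cycle :: "'v set set \<Rightarrow> 'v list \<Rightarrow> bool" where
  "is_cycle T vs \<longleftrightarrow> 3 \<le> length vs \<and> distinct vs \<and>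
     (\<forall>i. Suc i < length vs \<longrightarrow> {vs ! i, vs ! Suc i} \<in> T) \<and> {last vs, hd vs} \<in> T"

definition spanning_trees :: "'v set \<Rightarrow> 'v set set set" where
  "spanning_trees V =
     {T. T \<subseteq> complete_edges V \<and> edges_connected V T \<and> \<not> (\<exists>vs. is_cycle T vs)}"

text \<open>The nodes \<open>x 1, \<dots>, x n\<close> are identified with their indices, so coinciding points remain
  distinct nodes. For symmetric \<open>h\<close> the order of the two endpoints in an edge is irrelevant; minimum
  and maximum only serve to name them.\<close>

definition edge_weight ::
    "(real^2 \<Rightarrow> real^2 \<Rightarrow> real) \<Rightarrow> real \<Rightarrow> (nat \<Rightarrow> real^2) \<Rightarrow> nat set \<Rightarrow> real" where
  "edge_weight h \<alpha> x e = h (x (Min e)) (x (Max e)) powr \<alpha>"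

definition MST ::
    "(real^2 \<Rightarrow> real^2 \<Rightarrow> real) \<Rightarrow> real \<Rightarrow> nat \<Rightarrow> (nat \<Rightarrow> real^2) \<Rightarrow> real" where
  "MST h \<alpha> n x = Min ((\<lambda>T. \<Sum>e\<in>T. edge_weight h \<alpha> x e) ` spanning_trees {1..n})"

end

theory Submission
  imports Defs
begin

text \<open>The variance of \<open>MST h \<alpha> n\<close> comes from many small, almost independent local configurations.
Cut an axis-parallel square inside \<open>S\<^sub>0\<close> into about \<open>n\<close> cells of side of order \<open>n powr (- 1 / 2)\<close>.
With probability bounded below, the sample in a cell looks as follows: each of five tiny boxes (the shields),
arranged on two spiral arms around the centre of the cell, contains a sample point, one further sample point
sits in one of two tiny boxes (the far spot, at the centre, or the near spot), and the rest of the cell is empty.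

If the further point sits in the far spot, then for every other vertex outside the first shield there is a
shield point closer to both of them than they are to each other, so that in a minimal spanning tree the further
point is attached only to points of the first shield (\<open>shield_lune_near\<close>, \<open>shield_lune_far\<close>,
\<open>minimal_spanning_tree_lune\<close>). Moving the point to the near spot brings it closer to the first shield and thus
lowers the weight by at least a constant times the \<open>\<alpha>\<close>-th power of the scale, that is, by order
\<open>n powr (- \<alpha> / 2)\<close> (\<open>MST_shielded_swap\<close>).

This local effect is turned into a variance bound by the Cauchy-Schwarz inequality: for a centred \<open>G\<close>, the
variance of \<open>F\<close> is at least the square of \<open>E[G F]\<close> divided by \<open>E[G\<^sup>2]\<close>. Here \<open>G\<close> is the sum, over the indices
\<open>i\<close> and the cells, of a score: it is \<open>1\<close> if the point \<open>i\<close> sits in the far spot of a shielded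
cell and a negative number if it sits in the near spot, balanced so that the score has mean zero given all
other points. The scores of different indices are orthogonal: given the other points, the score of \<open>k\<close> does not
change when the point \<open>i\<close> moves between the two spots of a cell shielded by the other points
(\<open>total_score_orthogonal\<close>). Hence \<open>E[G\<^sup>2]\<close> has order at most \<open>n\<close>, while \<open>E[G F]\<close> has order at least
\<open>n powr (1 - \<alpha> / 2)\<close>, because there are \<open>n\<close> indices and about \<open>n\<close> cells, a point falls into a given far spot with
probability of order \<open>1 / n\<close>, and a cell is shielded with probability bounded below
(\<open>PiM_occupancy_lower_bound\<close>). The quotient has order \<open>n powr (1 - \<alpha>)\<close>.\<close>

section \<open>Connected graphs and minimal spanning trees\<close>

abbreviation reach :: "'v set set \<Rightarrow> ('v \<times> 'v) set" where
  "reach T \<equiv> {(a, b). {a, b} \<in> T}\<^sup>*"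

lemma reach_sym: "(u, v) \<in> reach T \<Longrightarrow> (v, u) \<in> reach T"
proof -
  have "sym {(a, b). {a, b} \<in> T}" by (auto simp: sym_def insert_commute)
  then show "(u, v) \<in> reach T \<Longrightarrow> (v, u) \<in> reach T" by (metis sym_rtrancl symD)
qed

lemma reach_mono: "T \<subseteq> T' \<Longrightarrow> reach T \<subseteq> reach T'"
  by (rule rtrancl_mono) auto

lemma edges_connectedD: "edges_connected V T \<Longrightarrow> u \<in> V \<Longrightarrow> v \<in> V \<Longrightarrow> (u, v) \<in> reach T"
  by (simp add: edges_connected_def)

lemma edges_connectedI_root:
  assumes "\<And>u. u \<in> V \<Longrightarrow> (s, u) \<in> reach T"
  shows "edges_connected V T"
  unfolding edges_connected_def
proof (intro ballI)
  fix u v assume "u \<in> V" "v \<in> V"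
  then show "(u, v) \<in> reach T" by (intro rtrancl_trans[OF reach_sym[OF assms] assms])
qed

text \<open>A walk that starts at \<open>y\<close> and uses the deleted edge \<open>{y, v}\<close> can be restarted at the last use of
that edge, either from \<open>y\<close> or from \<open>v\<close>.\<close>

lemma reach_delete_edge:
  assumes "(y, u) \<in> reach T"
  shows "(y, u) \<in> reach (T - {{y, v}}) \<or> (v, u) \<in> reach (T - {{y, v}})"
  using assms
proof (induction rule: rtrancl_induct)
  case base
  show ?case by simp
next
  case (step b c)
  show ?case
  proof (cases "{b, c} = {y, v}")
    case True
    then have "c = y \<or> c = v" by (auto simp: doubleton_eq_iff)
    then show ?thesis by auto
  next
    case False
    then have "(b, c) \<in> {(a, b). {a, b} \<in> T - {{y, v}}}" using step.hyps by auto
    then show ?thesis using step.IH by (meson rtrancl.rtrancl_into_rtrancl)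
  qed
qed

text \<open>Without \<open>{y, v}\<close>, every vertex still hangs together with \<open>y\<close> or with \<open>v\<close>. Whichever of the two
sides contains \<open>u\<close>, an edge from \<open>u\<close> to the other endpoint bridges the gap.\<close>

lemma edges_connected_exchange:
  assumes conn: "edges_connected V T" and V: "y \<in> V" "u \<in> V"
  shows "edges_connected V (insert {u, v} (T - {{y, v}})) \<or>
         edges_connected V (insert {u, y} (T - {{y, v}}))"
proof -
  let ?T = "T - {{y, v}}"
  have split: "(y, w) \<in> reach ?T \<or> (v, w) \<in> reach ?T" if "w \<in> V" for w
    by (rule reach_delete_edge, rule edges_connectedD[OF conn V(1) that])
  have bridge: "edges_connected V (insert {u, b} ?T)"
    if ab: "(a, u) \<in> reach ?T" and cover: "\<And>w. w \<in> V \<Longrightarrow> (a, w) \<in> reach ?T \<or> (b, w) \<in> reach ?T"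
    for a b
  proof (rule edges_connectedI_root[of _ a])
    fix w assume w: "w \<in> V"
    have m: "reach ?T \<subseteq> reach (insert {u, b} ?T)" by (rule reach_mono) auto
    have "(u, b) \<in> reach (insert {u, b} ?T)" by (rule r_into_rtrancl) simp
    with subsetD[OF m ab] have ab': "(a, b) \<in> reach (insert {u, b} ?T)" by (rule rtrancl_trans)
    from cover[OF w] show "(a, w) \<in> reach (insert {u, b} ?T)"
      by (elim disjE) (erule subsetD[OF m], rule rtrancl_trans[OF ab'], erule subsetD[OF m])
  qed
  from split[OF V(2)] show ?thesis
  proof
    assume "(y, u) \<in> reach ?T"
    from bridge[OF this split] show ?thesis ..
  next
    assume "(v, u) \<in> reach ?T"
    from bridge[OF this split[THEN disj_commute[THEN iffD1]]] show ?thesis ..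
  qed
qed

lemma reach_along_list:
  assumes "\<And>i. Suc i < length vs \<Longrightarrow> {vs ! i, vs ! Suc i} \<in> T" and "j < length vs"
  shows "(vs ! 0, vs ! j) \<in> reach T"
  using assms(2)
proof (induction j)
  case (Suc j)
  have "(vs ! j, vs ! Suc j) \<in> {(a, b). {a, b} \<in> T}" using assms(1) Suc.prems by auto
  then show ?case using Suc by (meson Suc_lessD rtrancl.rtrancl_into_rtrancl)
qed simp

text \<open>The remaining edges of the cycle are a detour around the deleted one. Length at least 3 and
distinctness guarantee that none of them coincides with it.\<close>

lemma edges_connected_delete_cycle_edge:
  assumes conn: "edges_connected V T" and cyc: "is_cycle T vs" and V: "\<And>e. e \<in> T \<Longrightarrow> e \<subseteq> V"
  shows "edges_connected V (T - {{last vs, hd vs}})"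
proof -
  let ?T = "T - {{last vs, hd vs}}"
  have len: "3 \<le> length vs" and dist: "distinct vs" and close: "{last vs, hd vs} \<in> T"
    and cons: "\<And>i. Suc i < length vs \<Longrightarrow> {vs ! i, vs ! Suc i} \<in> T"
    using cyc unfolding is_cycle_def by simp_all
  have "vs \<noteq> []" using len by auto
  then have hd: "hd vs = vs ! 0" and last: "last vs = vs ! (length vs - 1)"
    by (rule hd_conv_nth, rule last_conv_nth)
  have "{vs ! i, vs ! Suc i} \<in> ?T" if "Suc i < length vs" for i
  proof -
    have "{vs ! i, vs ! Suc i} \<noteq> {last vs, hd vs}"
    proof
      assume "{vs ! i, vs ! Suc i} = {last vs, hd vs}"
      then have "i = length vs - 1 \<and> Suc i = 0 \<or> i = 0 \<and> Suc i = length vs - 1"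
        unfolding hd last doubleton_eq_iff using len that \<open>vs \<noteq> []\<close>
        by (simp add: nth_eq_iff_index_eq[OF dist])
      then show False using len by linarith
    qed
    then show ?thesis using cons[OF that] by blast
  qed
  then have "(hd vs, last vs) \<in> reach ?T"
    unfolding hd last by (intro reach_along_list) (use len in simp_all)
  then have lh: "(last vs, hd vs) \<in> reach ?T" by (rule reach_sym)
  show ?thesis
  proof (rule edges_connectedI_root[of _ "last vs"])
    fix w assume w: "w \<in> V"
    have "last vs \<in> V" using V[OF close] by auto
    from edges_connectedD[OF conn this w] have "(last vs, w) \<in> reach T" .
    from reach_delete_edge[OF this, of "hd vs"]
    show "(last vs, w) \<in> reach ?T" by (elim disjE) (assumption, rule rtrancl_trans[OF lh])
  qed
qed

lemma finite_complete_edges: "finite V \<Longrightarrow> finite (complete_edges V)"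
  by (rule finite_subset[of _ "Pow V"]) (auto simp: complete_edges_def)

lemma finite_spanning_trees: "finite V \<Longrightarrow> finite (spanning_trees V)"
  by (rule finite_subset[of _ "Pow (complete_edges V)"])
     (auto simp: spanning_trees_def finite_complete_edges)

text \<open>Removing edges of cycles as long as there are any must end in a tree. This reduces all upper bounds for
the minimal weight to exhibiting connected graphs, with no need to check acyclicity.\<close>

lemma connected_contains_spanning_tree:
  assumes "finite V" "T \<subseteq> complete_edges V" "edges_connected V T"
  shows "\<exists>T'\<in>spanning_trees V. T' \<subseteq> T"
proof -
  have "finite T" by (rule finite_subset[OF assms(2) finite_complete_edges[OF assms(1)]])
  then show ?thesis using assms(2,3)
  proof (induction T rule: finite_psubset_induct)
    case (psubset T)
    show ?case
    proof (cases "\<exists>vs. is_cycle T vs")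
      case False
      then show ?thesis using psubset.prems by (auto simp: spanning_trees_def)
    next
      case True
      then obtain vs where vs: "is_cycle T vs" by blast
      let ?T = "T - {{last vs, hd vs}}"
      have "edges_connected V ?T"
        using psubset.prems vs by (intro edges_connected_delete_cycle_edge) (auto simp: complete_edges_def)
      moreover have "?T \<subset> T" using vs by (auto simp: is_cycle_def)
      ultimately show ?thesis using psubset.IH[of ?T] psubset.prems by blast
    qed
  qed
qed

lemma complete_edges_connected: "edges_connected V (complete_edges V)"
  unfolding edges_connected_def
proof (intro ballI)
  fix u v assume "u \<in> V" "v \<in> V"
  then show "(u, v) \<in> reach (complete_edges V)"
    by (cases "u = v") (simp, rule r_into_rtrancl, simp add: complete_edges_def)
qed

lemma spanning_trees_nonempty: "finite V \<Longrightarrow> spanning_trees V \<noteq> {}"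
  using connected_contains_spanning_tree[of V "complete_edges V"] complete_edges_connected by blast

lemma Min_spanning_trees_le_connected:
  fixes w :: "'v set \<Rightarrow> real"
  assumes "finite V" "T \<subseteq> complete_edges V" "edges_connected V T"
    and nonneg: "\<And>e. e \<in> T \<Longrightarrow> 0 \<le> w e"
  shows "Min (sum w ` spanning_trees V) \<le> sum w T"
proof -
  obtain T' where T': "T' \<in> spanning_trees V" "T' \<subseteq> T"
    using connected_contains_spanning_tree[OF assms(1-3)] by blast
  have "finite T" by (rule finite_subset[OF assms(2) finite_complete_edges[OF assms(1)]])
  have "Min (sum w ` spanning_trees V) \<le> sum w T'"
    using T' assms(1) by (intro Min_le) (auto simp: finite_spanning_trees)
  also have "\<dots> \<le> sum w T"
    using T'(2) nonneg \<open>finite T\<close> by (intro sum_mono2) auto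
  finally show ?thesis .
qed

text \<open>The lune property of minimal spanning trees: if both edges from \<open>u\<close> to the endpoints of \<open>{y, v}\<close> are
strictly cheaper than \<open>{y, v}\<close>, then one of them can replace it without losing connectedness.\<close>

lemma minimal_spanning_tree_lune:
  fixes w :: "'v set \<Rightarrow> real"
  assumes V: "finite V" "y \<in> V" "u \<in> V" "v \<in> V" and T: "T \<in> spanning_trees V"
    and min: "sum w T = Min (sum w ` spanning_trees V)"
    and nonneg: "\<And>e. e \<in> complete_edges V \<Longrightarrow> 0 \<le> w e"
    and u: "u \<noteq> y" "u \<noteq> v" "w {u, y} < w {y, v}" "w {u, v} < w {y, v}"
  shows "{y, v} \<notin> T"
proof
  assume yv: "{y, v} \<in> T"
  have TV: "T \<subseteq> complete_edges V" and conn: "edges_connected V T"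
    using T unfolding spanning_trees_def by blast+
  have fin: "finite T" by (rule finite_subset[OF TV finite_complete_edges[OF V(1)]])
  obtain b where b: "b = y \<or> b = v" and c: "edges_connected V (insert {u, b} (T - {{y, v}}))"
    using edges_connected_exchange[OF conn V(2,3), of v] by blast
  let ?T = "insert {u, b} (T - {{y, v}})"
  have sub: "?T \<subseteq> complete_edges V" using TV V b u by (auto simp: complete_edges_def)
  have "Min (sum w ` spanning_trees V) \<le> sum w ?T"
    using sub c nonneg V by (intro Min_spanning_trees_le_connected) auto
  also have "\<dots> \<le> w {u, b} + sum w (T - {{y, v}})"
    using fin sub nonneg by (cases "{u, b} \<in> T - {{y, v}}") (auto simp: insert_absorb)
  also have "\<dots> < w {y, v} + sum w (T - {{y, v}})" using b u by auto
  also have "\<dots> = sum w T" using fin yv by (simp add: sum.remove)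
  finally show False using min by simp
qed

lemma spanning_tree_meets_vertex:
  assumes "T \<in> spanning_trees V" "i \<in> V" "k \<in> V" "k \<noteq> i"
  shows "\<exists>e\<in>T. i \<in> e"
proof -
  have "edges_connected V T" using assms(1) unfolding spanning_trees_def by blast
  from edges_connectedD[OF this assms(2,3)] have "(i, k) \<in> reach T" .
  then show ?thesis
  proof (cases rule: converse_rtranclE)
    case base
    with assms(4) show ?thesis by simp
  next
    case (step b)
    from step(1) have "{i, b} \<in> T" by simp
    then show ?thesis by blast
  qed
qed

section \<open>Perturbing one coordinate of a product measure\<close>

text \<open>The factor in front of \<open>H\<close> has mean zero, so a constant may be subtracted from \<open>H\<close>. Subtracting the supremum
of \<open>H\<close> over \<open>Bm\<close> makes the contribution of \<open>Bm\<close> nonnegative and leaves at least \<open>\<Delta>\<close> on \<open>Bp\<close>.\<close>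

lemma integral_perturbation_lower_bound:
  fixes H :: "'b \<Rightarrow> real"
  assumes "prob_space \<mu>" and [measurable]: "Bp \<in> sets \<mu>" "Bm \<in> sets \<mu>" "H \<in> borel_measurable \<mu>"
    and bdd: "\<And>y. y \<in> space \<mu> \<Longrightarrow> \<bar>H y\<bar> \<le> c"
    and pos: "0 < measure \<mu> Bm"
    and gap: "\<And>y y'. y \<in> Bp \<Longrightarrow> y' \<in> Bm \<Longrightarrow> H y' + \<Delta> \<le> H y"
  shows "measure \<mu> Bp * \<Delta> \<le>
    (\<integral>y. (indicator Bp y - measure \<mu> Bp / measure \<mu> Bm * indicator Bm y) * H y \<partial>\<mu>)"
proof -
  interpret prob_space \<mu> by fact
  let ?\<kappa> = "measure \<mu> Bp / measure \<mu> Bm"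
  have sub: "Bp \<subseteq> space \<mu>" "Bm \<subseteq> space \<mu>" using assms(2,3)[THEN sets.sets_into_space] by auto
  have ne: "Bm \<noteq> {}" using pos by auto
  define s where "s = (SUP y\<in>Bm. H y)"
  have "bdd_above (H ` Bm)" using bdd sub by (intro bdd_aboveI[of _ c]) (auto simp: abs_le_iff)
  then have up: "H y \<le> s" if "y \<in> Bm" for y unfolding s_def using that by (rule cSUP_upper2) auto
  have lo: "s + \<Delta> \<le> H y" if "y \<in> Bp" for y
  proof -
    have "s \<le> H y - \<Delta>" unfolding s_def using ne gap[OF that] by (intro cSUP_least) (auto simp: le_diff_eq)
    then show ?thesis by simp
  qed
  have c0: "0 \<le> c" using bdd ne sub by force
  have iA: "integrable \<mu> (\<lambda>y. indicator A y * H y)" if [measurable]: "A \<in> sets \<mu>" for A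
    by (rule integrable_const_bound[where B=c]) (use bdd c0 in \<open>auto simp: indicator_def\<close>)
  have iC: "integrable \<mu> (\<lambda>y. indicator A y * (t::real))" if [measurable]: "A \<in> sets \<mu>" for A t
    by (rule integrable_const_bound[where B="\<bar>t\<bar>"]) (auto simp: indicator_def)
  have eC: "(\<integral>y. indicator A y * (t::real) \<partial>\<mu>) = measure \<mu> A * t" if "A \<in> sets \<mu>" for A t
    using that sets.sets_into_space[OF that] by (simp add: Int_absorb2)
  have "measure \<mu> Bp * \<Delta> = measure \<mu> Bp * (s + \<Delta>) - ?\<kappa> * (measure \<mu> Bm * s)"
    using pos by (simp add: field_simps)
  also have "\<dots> = (\<integral>y. indicator Bp y * (s + \<Delta>) \<partial>\<mu>) - ?\<kappa> * (\<integral>y. indicator Bm y * s \<partial>\<mu>)"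
    by (simp add: eC del: integral_mult_left_zero)
  also have "\<dots> \<le> (\<integral>y. indicator Bp y * H y \<partial>\<mu>) - ?\<kappa> * (\<integral>y. indicator Bm y * H y \<partial>\<mu>)"
  proof (rule diff_mono)
    show "(\<integral>y. indicator Bp y * (s + \<Delta>) \<partial>\<mu>) \<le> (\<integral>y. indicator Bp y * H y \<partial>\<mu>)"
      by (rule integral_mono[OF iC iA]) (auto simp: lo split: split_indicator)
    have "(\<integral>y. indicator Bm y * H y \<partial>\<mu>) \<le> (\<integral>y. indicator Bm y * s \<partial>\<mu>)"
      by (rule integral_mono[OF iA iC]) (auto simp: up split: split_indicator)
    then show "?\<kappa> * (\<integral>y. indicator Bm y * H y \<partial>\<mu>) \<le> ?\<kappa> * (\<integral>y. indicator Bm y * s \<partial>\<mu>)"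
      by (rule mult_left_mono) simp
  qed
  also have "\<dots> = (\<integral>y. indicator Bp y * H y - ?\<kappa> * (indicator Bm y * H y) \<partial>\<mu>)"
    by (subst Bochner_Integration.integral_diff) (auto intro!: iA integrable_mult_right simp del: times_divide_eq_left)
  also have "\<dots> = (\<integral>y. (indicator Bp y - ?\<kappa> * indicator Bm y) * H y \<partial>\<mu>)"
    by (simp add: algebra_simps)
  finally show ?thesis .
qed

text \<open>The one-coordinate bound, integrated over the other coordinates by Fubini: \<open>C\<close> is an event about the
other coordinates on which moving coordinate \<open>i\<close> from \<open>Bm\<close> to \<open>Bp\<close> raises \<open>H\<close> by at least \<open>\<Delta>\<close>.\<close>

lemma PiM_perturbation_lower_bound:
  fixes H :: "('i \<Rightarrow> 'b) \<Rightarrow> real" and \<mu> :: "'b measure" and I :: "'i set"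
  assumes P: "prob_space \<mu>" and I: "finite I" "i \<in> I"
    and [measurable]: "Bp \<in> sets \<mu>" "Bm \<in> sets \<mu>" "H \<in> borel_measurable (PiM I (\<lambda>_. \<mu>))"
      "Measurable.pred (PiM I (\<lambda>_. \<mu>)) C" "Measurable.pred (PiM (I - {i}) (\<lambda>_. \<mu>)) C"
    and indep: "\<And>x y. C (x(i := y)) = C x"
    and bdd: "\<And>x. x \<in> space (PiM I (\<lambda>_. \<mu>)) \<Longrightarrow> \<bar>H x\<bar> \<le> c"
    and pos: "0 < measure \<mu> Bm"
    and gap: "\<And>x y y'. x \<in> space (PiM (I - {i}) (\<lambda>_. \<mu>)) \<Longrightarrow> C x \<Longrightarrow> y \<in> Bp \<Longrightarrow> y' \<in> Bm \<Longrightarrow>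
        H (x(i := y')) + \<Delta> \<le> H (x(i := y))"
  shows "measure \<mu> Bp * \<Delta> * measure (PiM (I - {i}) (\<lambda>_. \<mu>)) {x\<in>space (PiM (I - {i}) (\<lambda>_. \<mu>)). C x} \<le>
    (\<integral>x. (if C x then indicator Bp (x i) - measure \<mu> Bp / measure \<mu> Bm * indicator Bm (x i) else 0) * H x
       \<partial>PiM I (\<lambda>_. \<mu>))"
proof -
  interpret \<mu>: prob_space \<mu> by fact
  interpret product_sigma_finite "\<lambda>_. \<mu>" by unfold_locales
  let ?N = "PiM I (\<lambda>_. \<mu>)" and ?J = "PiM (I - {i}) (\<lambda>_. \<mu>)"
  interpret N: prob_space ?N by (intro prob_space_PiM assms(1))
  interpret J: prob_space ?J by (intro prob_space_PiM assms(1))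
  let ?\<psi> = "\<lambda>y. indicator Bp y - measure \<mu> Bp / measure \<mu> Bm * indicator Bm y :: real"
  let ?f = "\<lambda>x. (if C x then ?\<psi> (x i) else 0) * H x"
  have ins: "insert i (I - {i}) = I" using I by auto
  define K where "K = 1 + measure \<mu> Bp / measure \<mu> Bm"
  have K: "0 \<le> K" "\<bar>?\<psi> y\<bar> \<le> K" for y
  proof -
    have "0 \<le> measure \<mu> Bp / measure \<mu> Bm" by simp
    then show "0 \<le> K" "\<bar>?\<psi> y\<bar> \<le> K" unfolding K_def
      by (auto simp: abs_le_iff split: split_indicator)
  qed
  have [measurable]: "(\<lambda>x. x i) \<in> ?N \<rightarrow>\<^sub>M \<mu>" using I by simp
  have [measurable]: "?f \<in> borel_measurable ?N" by measurable
  have fbd: "norm (?f x) \<le> K * c" if x: "x \<in> space ?N" for x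
  proof -
    have "\<bar>if C x then ?\<psi> (x i) else 0\<bar> \<le> K" using K by simp
    then show ?thesis using K(1) bdd[OF x] unfolding real_norm_def abs_mult by (intro mult_mono) auto
  qed
  then have int: "integrable ?N ?f"
    by (intro N.integrable_const_bound[where B="K * c"] AE_I2) auto
  have upd: "x(i := y) \<in> space ?N" if "x \<in> space ?J" "y \<in> space \<mu>" for x y
    using that I by (auto simp: space_PiM PiE_iff extensional_def)
  have updm: "(\<lambda>y. x(i := y)) \<in> \<mu> \<rightarrow>\<^sub>M ?N" if "x \<in> space ?J" for x
    using that I by (intro measurable_fun_upd[where J="I - {i}"]) auto
  have fmeas: "(\<lambda>y. ?f (x(i := y))) \<in> borel_measurable \<mu>" if "x \<in> space ?J" for x
    by (rule measurable_compose[OF updm[OF that]]) simp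
  have inti: "integrable ?J (\<lambda>x. \<integral>y. ?f (x(i := y)) \<partial>\<mu>)"
  proof (rule J.integrable_const_bound[where B="K * c"])
    have "(\<lambda>x. \<integral>y. ?f (x(i := y)) \<partial>\<mu>) \<in> borel_measurable ?J"
    proof (rule \<mu>.borel_measurable_lebesgue_integral)
      have "(\<lambda>(x, y). x(i := y)) \<in> ?J \<Otimes>\<^sub>M \<mu> \<rightarrow>\<^sub>M ?N"
        using measurable_add_dim[of i "I - {i}" "\<lambda>_. \<mu>"] unfolding ins .
      then show "(\<lambda>(x, y). ?f (x(i := y))) \<in> borel_measurable (?J \<Otimes>\<^sub>M \<mu>)"
        using measurable_compose[where g="?f" and N="?N" and L=borel] by (simp add: split_beta')
    qed
    then show "(\<lambda>x. \<integral>y. ?f (x(i := y)) \<partial>\<mu>) \<in> borel_measurable ?J" .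
    have "norm (\<integral>y. ?f (x(i := y)) \<partial>\<mu>) \<le> K * c" if x: "x \<in> space ?J" for x
    proof -
      have "norm (\<integral>y. ?f (x(i := y)) \<partial>\<mu>) \<le> (\<integral>y. norm (?f (x(i := y))) \<partial>\<mu>)"
        by (rule integral_norm_bound)
      also have "\<dots> \<le> (\<integral>y. K * c \<partial>\<mu>)"
      proof (rule integral_mono)
        show "integrable \<mu> (\<lambda>y. norm (?f (x(i := y))))"
          using fbd upd[OF x] fmeas[OF x]
          by (intro integrable_norm \<mu>.integrable_const_bound[where B="K * c"] AE_I2) auto
      qed (use fbd upd[OF x] in auto)
      finally show ?thesis by (simp add: \<mu>.prob_space)
    qed
    then show "AE x in ?J. norm (\<integral>y. ?f (x(i := y)) \<partial>\<mu>) \<le> K * c" by (intro AE_I2)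
  qed
  have "measure \<mu> Bp * \<Delta> * measure ?J {x\<in>space ?J. C x} =
      (\<integral>x. measure \<mu> Bp * \<Delta> * indicator {x\<in>space ?J. C x} x \<partial>?J)"
    by (simp add: Int_absorb2 subset_eq)
  also have "\<dots> \<le> (\<integral>x. (\<integral>y. ?f (x(i := y)) \<partial>\<mu>) \<partial>?J)"
  proof (rule integral_mono[OF _ inti])
    fix x assume x: "x \<in> space ?J"
    show "measure \<mu> Bp * \<Delta> * indicator {x\<in>space ?J. C x} x \<le> (\<integral>y. ?f (x(i := y)) \<partial>\<mu>)"
    proof (cases "C x")
      case True
      note [measurable] = updm[OF x]
      have "measure \<mu> Bp * \<Delta> \<le> (\<integral>y. ?\<psi> y * H (x(i := y)) \<partial>\<mu>)"
        by (rule integral_perturbation_lower_bound[where c=c])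
          (use assms(1) pos gap[OF x True] bdd upd x in auto)
      then show ?thesis using x True indep by simp
    qed (simp add: indep)
  next
    have "{x\<in>space ?J. C x} \<in> sets ?J" by measurable
    then show "integrable ?J (\<lambda>x. measure \<mu> Bp * \<Delta> * indicator {x\<in>space ?J. C x} x)"
      by (intro integrable_mult_right integrable_real_indicator) (auto simp: J.emeasure_eq_measure)
  qed
  also have "\<dots> = (\<integral>x. ?f x \<partial>?N)"
    by (rule product_integral_insert[of "I - {i}" i ?f, unfolded ins, symmetric]) (use int I in auto)
  finally show ?thesis .
qed

text \<open>The disjoint blocks \<open>I t\<close> of indices only serve to count: for every choice of one index \<open>\<sigma> t\<close> from each
block, consider the product event that coordinate \<open>\<sigma> t\<close> lies in \<open>W t\<close> for all \<open>t\<close> and all other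
coordinates avoid \<open>Q\<close>. These events are pairwise disjoint, and each has probability at least
\<open>w ^ m * (1 - q) ^ card J\<close>.\<close>

lemma PiM_occupancy_lower_bound:
  fixes W :: "nat \<Rightarrow> 'b set" and \<mu> :: "'b measure" and J :: "'i set"
  assumes "prob_space \<mu>" and J: "finite J" and Q: "Q \<in> sets \<mu>" "measure \<mu> Q \<le> q" "q \<le> 1"
    and W: "\<And>t. t < m \<Longrightarrow> W t \<in> sets \<mu>" "\<And>t. t < m \<Longrightarrow> W t \<subseteq> Q"
      "\<And>t. t < m \<Longrightarrow> w \<le> measure \<mu> (W t)" "0 \<le> w"
    and I: "\<And>t. t < m \<Longrightarrow> I t \<subseteq> J" "disjoint_family_on I {..<m}" "\<And>t. t < m \<Longrightarrow> L \<le> card (I t)"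
  shows "(real L * w) ^ m * (1 - q) ^ card J \<le> measure (PiM J (\<lambda>_. \<mu>)) {x\<in>space (PiM J (\<lambda>_. \<mu>)).
     (\<forall>k\<in>J. x k \<in> Q \<longrightarrow> (\<exists>t<m. x k \<in> W t)) \<and> (\<forall>t<m. \<exists>k\<in>J. x k \<in> W t)}"
    (is "_ \<le> measure ?N ?A")
proof -
  interpret \<mu>: prob_space \<mu> by fact
  interpret finite_product_prob_space "\<lambda>_. \<mu>" J by unfold_locales (rule J)
  define \<Sigma> where "\<Sigma> = PiE {..<m} I"
  have finI: "finite (I t)" if "t < m" for t using I(1)[OF that] J finite_subset by blast
  have fin\<Sigma>: "finite \<Sigma>" unfolding \<Sigma>_def using finI by (intro finite_PiE) auto
  have card\<Sigma>: "real L ^ m \<le> real (card \<Sigma>)"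
  proof -
    have "L ^ m = (\<Prod>t<m. L)" by simp
    also have "\<dots> \<le> (\<Prod>t<m. card (I t))" using I(3) by (intro prod_mono) auto
    also have "\<dots> = card \<Sigma>" unfolding \<Sigma>_def by (simp add: card_PiE)
    finally show ?thesis by (metis of_nat_mono of_nat_power)
  qed
  have mem: "\<sigma> t \<in> I t" if "\<sigma> \<in> \<Sigma>" "t < m" for \<sigma> t using that by (auto simp: \<Sigma>_def)
  have idx: "s = t" if "k \<in> I s" "k \<in> I t" "s < m" "t < m" for s t k
    using I(2) that by (auto simp: disjoint_family_on_def)
  have inj: "inj_on \<sigma> {..<m}" if "\<sigma> \<in> \<Sigma>" for \<sigma>
    using mem[OF that] idx by (intro inj_onI) (metis lessThan_iff)
  define E where "E \<sigma> k = (if k \<in> \<sigma> ` {..<m} then W (inv_into {..<m} \<sigma> k) else space \<mu> - Q)" for \<sigma> :: "nat \<Rightarrow> 'i" and k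
  have E_W: "E \<sigma> (\<sigma> t) = W t" if "\<sigma> \<in> \<Sigma>" "t < m" for \<sigma> t
    using that inj by (auto simp: E_def)
  have E_sets: "E \<sigma> k \<in> sets \<mu>" if "\<sigma> \<in> \<Sigma>" for \<sigma> k
  proof (cases "k \<in> \<sigma> ` {..<m}")
    case True
    then show ?thesis using that E_W W by auto
  qed (use Q in \<open>auto simp: E_def\<close>)
  let ?B = "\<lambda>\<sigma>. PiE J (E \<sigma>)"
  have B_sets: "?B \<sigma> \<in> sets ?N" if "\<sigma> \<in> \<Sigma>" for \<sigma>
    using J E_sets[OF that] by (intro sets_PiM_I_finite) auto
  have B_measure: "w ^ m * (1 - q) ^ card J \<le> measure ?N (?B \<sigma>)" if \<sigma>: "\<sigma> \<in> \<Sigma>" for \<sigma>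
  proof -
    let ?S = "\<sigma> ` {..<m}"
    have S: "?S \<subseteq> J" "card ?S = m" using mem[OF \<sigma>] I(1) inj[OF \<sigma>] by (auto simp: card_image)
    have "w ^ m * (1 - q) ^ card J \<le> w ^ m * (1 - q) ^ card (J - ?S)"
      using W(4) Q(3) J order_trans[OF measure_nonneg Q(2)] by (intro mult_left_mono power_decreasing card_mono) auto
    also have "\<dots> = (\<Prod>k\<in>?S. w) * (\<Prod>k\<in>J - ?S. 1 - q)" by (simp add: S(2))
    also have "\<dots> \<le> (\<Prod>k\<in>?S. measure \<mu> (E \<sigma> k)) * (\<Prod>k\<in>J - ?S. measure \<mu> (E \<sigma> k))"
    proof (intro mult_mono prod_mono conjI)
      fix k assume "k \<in> ?S"
      then show "w \<le> measure \<mu> (E \<sigma> k)" using E_W[OF \<sigma>] W by auto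
    next
      fix k assume "k \<in> J - ?S"
      then have "measure \<mu> (E \<sigma> k) = 1 - measure \<mu> Q" by (simp add: E_def \<mu>.prob_compl Q)
      then show "1 - q \<le> measure \<mu> (E \<sigma> k)" using Q by simp
    qed (use W Q in \<open>auto intro: prod_nonneg\<close>)
    also have "\<dots> = (\<Prod>k\<in>J. measure \<mu> (E \<sigma> k))"
      using J S by (simp add: prod.subset_diff mult.commute)
    also have "\<dots> = measure ?N (?B \<sigma>)" using E_sets[OF \<sigma>] by (intro prob_times[symmetric]) auto
    finally show ?thesis .
  qed
  have disj: "disjoint_family_on ?B \<Sigma>"
  proof (unfold disjoint_family_on_def, intro ballI impI)
    fix \<sigma> \<tau> assume *: "\<sigma> \<in> \<Sigma>" "\<tau> \<in> \<Sigma>" "\<sigma> \<noteq> \<tau>"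
    then obtain t where t: "t < m" "\<sigma> t \<noteq> \<tau> t" unfolding \<Sigma>_def by (metis PiE_ext lessThan_iff)
    have n: "\<sigma> t \<notin> \<tau> ` {..<m}"
    proof
      assume "\<sigma> t \<in> \<tau> ` {..<m}"
      then obtain s where s: "s < m" "\<sigma> t = \<tau> s" by auto
      then have "s = t" using idx[of "\<sigma> t" s t] mem * t by metis
      then show False using s t by simp
    qed
    have k: "\<sigma> t \<in> J" using mem * t I(1) by blast
    have "x (\<sigma> t) \<in> W t" if "x \<in> ?B \<sigma>" for x using that k E_W[OF *(1) t(1)] by (auto simp: PiE_iff)
    moreover have "x (\<sigma> t) \<notin> Q" if "x \<in> ?B \<tau>" for x
    proof -
      have "x (\<sigma> t) \<in> E \<tau> (\<sigma> t)" using that k by (auto simp: PiE_iff)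
      then show ?thesis using n by (simp add: E_def)
    qed
    ultimately show "?B \<sigma> \<inter> ?B \<tau> = {}" using W(2)[OF t(1)] by blast
  qed
  have sub: "?B \<sigma> \<subseteq> ?A" if \<sigma>: "\<sigma> \<in> \<Sigma>" for \<sigma>
  proof
    fix x assume x: "x \<in> ?B \<sigma>"
    have "x \<in> space ?N" using x sets.sets_into_space[OF B_sets[OF \<sigma>]] by blast
    moreover have "\<exists>t<m. x k \<in> W t" if k: "k \<in> J" "x k \<in> Q" for k
    proof (cases "k \<in> \<sigma> ` {..<m}")
      case True
      then obtain t where t: "t < m" "k = \<sigma> t" by auto
      have "x k \<in> E \<sigma> k" using x k by (auto simp: PiE_iff)
      then show ?thesis using E_W[OF \<sigma>] t by auto
    next
      case False
      have "x k \<in> E \<sigma> k" using x k by (auto simp: PiE_iff)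
      then show ?thesis using False k by (simp add: E_def)
    qed
    moreover have "\<exists>k\<in>J. x k \<in> W t" if "t < m" for t
    proof
      show k: "\<sigma> t \<in> J" using mem[OF \<sigma>] that I(1) by blast
      show "x (\<sigma> t) \<in> W t" using x k E_W[OF \<sigma> that] by (auto simp: PiE_iff)
    qed
    ultimately show "x \<in> ?A" by blast
  qed
  have A_sets: "?A \<in> sets ?N"
  proof -
    have "?A = {x\<in>space ?N. \<forall>k\<in>J. x k \<in> Q \<longrightarrow> (\<exists>t\<in>{..<m}. x k \<in> W t)} \<inter>
               {x\<in>space ?N. \<forall>t\<in>{..<m}. \<exists>k\<in>J. x k \<in> W t}" by auto
    also have "\<dots> \<in> sets ?N"
      using Q W J by (intro sets.Int sets.sets_Collect_finite_All sets.sets_Collect_imp sets.sets_Collect_finite_Ex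
          measurable_sets_Collect[OF measurable_component_singleton]) auto
    finally show ?thesis .
  qed
  have "(real L * w) ^ m * (1 - q) ^ card J = real L ^ m * (w ^ m * (1 - q) ^ card J)"
    by (simp add: power_mult_distrib)
  also have "\<dots> \<le> real (card \<Sigma>) * (w ^ m * (1 - q) ^ card J)"
    using W(4) Q(3) card\<Sigma> by (intro mult_right_mono) auto
  also have "\<dots> = (\<Sum>\<sigma>\<in>\<Sigma>. w ^ m * (1 - q) ^ card J)" by simp
  also have "\<dots> \<le> (\<Sum>\<sigma>\<in>\<Sigma>. measure ?N (?B \<sigma>))" by (intro sum_mono B_measure)
  also have "\<dots> = measure ?N (\<Union>\<sigma>\<in>\<Sigma>. ?B \<sigma>)"
    using fin\<Sigma> B_sets disj by (intro finite_measure_finite_Union[symmetric]) auto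
  also have "\<dots> \<le> measure ?N ?A" using sub A_sets by (intro finite_measure_mono UN_least)
  finally show ?thesis .
qed

text \<open>Cauchy-Schwarz for the covariance of \<open>F\<close> with a centred test statistic \<open>G\<close>, read off from the
nonnegative second moment of \<open>F - E[F] - l * G\<close> at \<open>l = A / B\<close>.\<close>

lemma (in prob_space) variance_ge_covariance_test:
  fixes F G :: "'a \<Rightarrow> real"
  assumes [measurable]: "F \<in> borel_measurable M" "G \<in> borel_measurable M"
    and F: "\<And>x. x \<in> space M \<Longrightarrow> \<bar>F x\<bar> \<le> c" and G: "\<And>x. x \<in> space M \<Longrightarrow> \<bar>G x\<bar> \<le> d"
    and mean: "expectation G = 0" and B: "expectation (\<lambda>x. G x ^ 2) \<le> B" "0 < B"
    and A: "A \<le> expectation (\<lambda>x. G x * F x)" "0 \<le> A"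
  shows "A\<^sup>2 / B \<le> variance F"
proof -
  have bd: "integrable M (\<lambda>x. H x)" if "H \<in> borel_measurable M" "\<And>x. x \<in> space M \<Longrightarrow> \<bar>H x\<bar> \<le> e"
    for H :: "'a \<Rightarrow> real" and e using that by (intro integrable_const_bound[where B=e] AE_I2) auto
  have iF: "integrable M F" and iG: "integrable M G" by (rule bd; use F G in auto)+
  define e where "e = expectation F"
  define l where "l = A / B"
  have l: "0 \<le> l" using A B by (simp add: l_def)
  have F': "\<bar>F x - e\<bar> \<le> c + \<bar>e\<bar>" if "x \<in> space M" for x using F[OF that] by linarith
  have i1: "integrable M (\<lambda>x. (F x - e)\<^sup>2)"
  proof (rule bd[of _ "(c + \<bar>e\<bar>)\<^sup>2"])
    fix x assume "x \<in> space M"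
    from power_mono[OF F'[OF this], of 2] show "\<bar>(F x - e)\<^sup>2\<bar> \<le> (c + \<bar>e\<bar>)\<^sup>2" by simp
  qed simp
  have i2: "integrable M (\<lambda>x. (G x)\<^sup>2)"
  proof (rule bd[of _ "d\<^sup>2"])
    fix x assume "x \<in> space M"
    from power_mono[OF G[OF this], of 2] show "\<bar>(G x)\<^sup>2\<bar> \<le> d\<^sup>2" by simp
  qed simp
  have i3: "integrable M (\<lambda>x. G x * F x)"
  proof (rule bd[of _ "d * c"])
    fix x assume x: "x \<in> space M"
    show "\<bar>G x * F x\<bar> \<le> d * c"
      using mult_mono[OF G[OF x] F[OF x]] order_trans[OF abs_ge_zero G[OF x]] by (simp add: abs_mult)
  qed simp
  have "0 \<le> expectation (\<lambda>x. (F x - e - l * G x)\<^sup>2)" by (rule integral_nonneg_AE) simp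
  also have "(\<lambda>x. (F x - e - l * G x)\<^sup>2) =
      (\<lambda>x. (F x - e)\<^sup>2 - 2 * l * (G x * F x) + 2 * l * e * G x + l\<^sup>2 * (G x)\<^sup>2)"
    by (simp add: power2_eq_square algebra_simps)
  also have "expectation \<dots> = variance F - 2 * l * expectation (\<lambda>x. G x * F x) + l\<^sup>2 * expectation (\<lambda>x. (G x)\<^sup>2)"
    using i1 i2 i3 iG mean by (simp add: e_def)
  also have "\<dots> \<le> variance F - 2 * l * A + l\<^sup>2 * B"
    using A B l by (intro add_mono diff_mono mult_left_mono) auto
  also have "\<dots> = variance F - A\<^sup>2 / B" using B by (simp add: l_def power2_eq_square field_simps)
  finally show ?thesis by simp
qed

section \<open>Variance bounds from shielded local perturbations\<close>

text \<open>The setting for the test statistic: independent points with distribution \<open>\<mu>\<close>, indexed by \<open>I\<close>, and pairwise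
disjoint cells \<open>Q z\<close>, each with shields \<open>W z t\<close> and two spots \<open>Bp z\<close> and \<open>Bm z\<close> between which a point is
moved. Spots and shields are disjoint, so that a cell cannot be shielded by a point that sits in one of its
spots. The constant \<open>K\<close> bounds the scores.\<close>

locale local_perturbation = prob_space \<mu> for \<mu> :: "'b measure" +
  fixes I :: "'i set" and Z :: "'z set" and Q Bp Bm :: "'z \<Rightarrow> 'b set" and W :: "'z \<Rightarrow> nat \<Rightarrow> 'b set"
    and m :: nat and K :: real
  assumes finite_I: "finite I" and finite_Z: "finite Z"
    and sets_cell: "\<And>z. z \<in> Z \<Longrightarrow> Q z \<in> sets \<mu>"
    and sets_swap: "\<And>z. z \<in> Z \<Longrightarrow> Bp z \<in> sets \<mu>" "\<And>z. z \<in> Z \<Longrightarrow> Bm z \<in> sets \<mu>"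
    and sets_shield: "\<And>z t. z \<in> Z \<Longrightarrow> t < m \<Longrightarrow> W z t \<in> sets \<mu>"
    and swap_in_cell: "\<And>z. z \<in> Z \<Longrightarrow> Bp z \<subseteq> Q z" "\<And>z. z \<in> Z \<Longrightarrow> Bm z \<subseteq> Q z"
    and swap_disjoint: "\<And>z. z \<in> Z \<Longrightarrow> Bp z \<inter> Bm z = {}"
    and shield_in_cell: "\<And>z t. z \<in> Z \<Longrightarrow> t < m \<Longrightarrow> W z t \<subseteq> Q z"
    and shield_disjoint: "\<And>z t. z \<in> Z \<Longrightarrow> t < m \<Longrightarrow> W z t \<inter> (Bp z \<union> Bm z) = {}"
    and cells_disjoint: "disjoint_family_on Q Z"
    and swap_measure: "\<And>z. z \<in> Z \<Longrightarrow> 0 < measure \<mu> (Bm z)"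
      "\<And>z. z \<in> Z \<Longrightarrow> measure \<mu> (Bp z) \<le> K * measure \<mu> (Bm z)"
    and K_ge_1: "1 \<le> K"
begin

text \<open>A shield may contain several points, since a lune argument uses just one of them, but the cell must not contain
points outside the shields, which could be attached to a point in a spot.\<close>

definition shielded :: "'i set \<Rightarrow> 'z \<Rightarrow> ('i \<Rightarrow> 'b) \<Rightarrow> bool" where
  "shielded J z x \<longleftrightarrow> (\<forall>k\<in>J. x k \<in> Q z \<longrightarrow> (\<exists>t<m. x k \<in> W z t)) \<and> (\<forall>t<m. \<exists>k\<in>J. x k \<in> W z t)"

text \<open>The coefficient of the second indicator makes the mean under \<open>\<mu>\<close> zero.\<close>

definition swap_sign :: "'z \<Rightarrow> 'b \<Rightarrow> real" where
  "swap_sign z y = indicator (Bp z) y - measure \<mu> (Bp z) / measure \<mu> (Bm z) * indicator (Bm z) y"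

definition score :: "'i \<Rightarrow> 'z \<Rightarrow> ('i \<Rightarrow> 'b) \<Rightarrow> real" where
  "score i z x = (if shielded (I - {i}) z x then swap_sign z (x i) else 0)"

definition total_score :: "'i \<Rightarrow> ('i \<Rightarrow> 'b) \<Rightarrow> real" where
  "total_score i x = (\<Sum>z\<in>Z. score i z x)"

abbreviation "sample J \<equiv> PiM J (\<lambda>_::'i. \<mu>)"

lemma prob_space_sample: "prob_space (sample J)"
  by (rule prob_space_PiM) unfold_locales

lemma pred_shielded:
  assumes "J \<subseteq> I" "J \<subseteq> L" "z \<in> Z"
  shows "Measurable.pred (sample L) (shielded J z)"
proof -
  have "{x\<in>space (sample L). shielded J z x} =
      {x\<in>space (sample L). \<forall>k\<in>J. x k \<in> Q z \<longrightarrow> (\<exists>t\<in>{..<m}. x k \<in> W z t)} \<inter>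
      {x\<in>space (sample L). \<forall>t\<in>{..<m}. \<exists>k\<in>J. x k \<in> W z t}" by (auto simp: shielded_def)
  also have "\<dots> \<in> sets (sample L)"
    using sets_cell[OF assms(3)] sets_shield[OF assms(3)] finite_subset[OF assms(1) finite_I] assms(2)
    by (intro sets.Int sets.sets_Collect_finite_All sets.sets_Collect_imp sets.sets_Collect_finite_Ex
          measurable_sets_Collect[OF measurable_component_singleton]) auto
  finally show ?thesis by (simp add: pred_def)
qed

lemma measurable_score:
  assumes "i \<in> I" "z \<in> Z"
  shows "score i z \<in> borel_measurable (sample I)"
proof -
  have [measurable]: "Measurable.pred (sample I) (shielded (I - {i}) z)"
    "Bp z \<in> sets \<mu>" "Bm z \<in> sets \<mu>" "(\<lambda>x. x i) \<in> sample I \<rightarrow>\<^sub>M \<mu>"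
    using pred_shielded[of "I - {i}" I z] sets_swap assms by auto
  show ?thesis unfolding score_def swap_sign_def by measurable
qed

lemma measurable_total_score: "i \<in> I \<Longrightarrow> total_score i \<in> borel_measurable (sample I)"
  unfolding total_score_def by (intro borel_measurable_sum measurable_score)

lemma shielded_upd: "shielded (I - {i}) z (x(i := y)) = shielded (I - {i}) z x"
  by (auto simp: shielded_def)

lemma swap_sign_outside: "z \<in> Z \<Longrightarrow> y \<notin> Q z \<Longrightarrow> swap_sign z y = 0"
  using swap_in_cell by (auto simp: swap_sign_def indicator_def)

lemma swap_sign_shield: "z \<in> Z \<Longrightarrow> t < m \<Longrightarrow> y \<in> W z t \<Longrightarrow> swap_sign z y = 0"
  using shield_disjoint by (fastforce simp: swap_sign_def indicator_def)

lemma abs_swap_sign: 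
  assumes "z \<in> Z"
  shows "\<bar>swap_sign z y\<bar> \<le> K"
proof -
  have "measure \<mu> (Bp z) / measure \<mu> (Bm z) \<le> K"
    using swap_measure[OF assms] by (simp add: divide_le_eq)
  then show ?thesis using swap_disjoint[OF assms] K_ge_1
    by (auto simp: swap_sign_def indicator_def)
qed

lemma abs_score: "z \<in> Z \<Longrightarrow> \<bar>score i z x\<bar> \<le> K"
  using abs_swap_sign[of z "x i"] K_ge_1 by (simp add: score_def)

text \<open>The point \<open>x i\<close> lies in at most one cell, so at most one summand is nonzero.\<close>

lemma abs_total_score: "\<bar>total_score i x\<bar> \<le> K"
proof (cases "\<exists>z\<in>Z. x i \<in> Q z")
  case True
  then obtain z where z: "z \<in> Z" "x i \<in> Q z" by blast
  have "score i z' x = 0" if "z' \<in> Z - {z}" for z'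
  proof -
    have "x i \<notin> Q z'" using cells_disjoint z that by (auto simp: disjoint_family_on_def)
    then show ?thesis using that swap_sign_outside by (simp add: score_def)
  qed
  then have "total_score i x = score i z x"
    using z finite_Z by (simp add: total_score_def sum.remove)
  then show ?thesis using abs_score z by simp
next
  case False
  then have "total_score i x = 0"
    unfolding total_score_def score_def by (intro sum.neutral) (auto simp: swap_sign_outside)
  then show ?thesis using K_ge_1 by simp
qed

lemma expectation_score_ge:
  assumes "i \<in> I" "z \<in> Z" "H \<in> borel_measurable (sample I)"
    and "\<And>x. x \<in> space (sample I) \<Longrightarrow> \<bar>H x\<bar> \<le> c"
    and "\<And>x y y'. x \<in> space (sample (I - {i})) \<Longrightarrow> shielded (I - {i}) z x \<Longrightarrow>
      y \<in> Bp z \<Longrightarrow> y' \<in> Bm z \<Longrightarrow> H (x(i := y')) + \<Delta> \<le> H (x(i := y))"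
  shows "measure \<mu> (Bp z) * \<Delta> *
      measure (sample (I - {i})) {x\<in>space (sample (I - {i})). shielded (I - {i}) z x} \<le>
    (\<integral>x. score i z x * H x \<partial>sample I)"
  unfolding score_def swap_sign_def
  using assms sets_swap swap_measure(1) finite_I
  by (intro PiM_perturbation_lower_bound[where c=c]) (auto simp: shielded_upd pred_shielded prob_space_axioms)

lemma expectation_score_eq_0:
  assumes "i \<in> I" "z \<in> Z" and H: "H \<in> borel_measurable (sample I)"
    "\<And>x. x \<in> space (sample I) \<Longrightarrow> \<bar>H x\<bar> \<le> c"
    and eq: "\<And>x y y'. x \<in> space (sample (I - {i})) \<Longrightarrow> shielded (I - {i}) z x \<Longrightarrow>
      y \<in> Bp z \<Longrightarrow> y' \<in> Bm z \<Longrightarrow> H (x(i := y')) = H (x(i := y))"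
  shows "(\<integral>x. score i z x * H x \<partial>sample I) = 0"
proof -
  have "0 \<le> (\<integral>x. score i z x * H x \<partial>sample I)"
    using expectation_score_ge[of i z H c 0] assms by simp
  moreover have "0 \<le> (\<integral>x. score i z x * - H x \<partial>sample I)"
    using expectation_score_ge[of i z "\<lambda>x. - H x" c 0] assms by simp
  ultimately show ?thesis by simp
qed

lemma integrable_score_mult:
  assumes "i \<in> I" "z \<in> Z" "H \<in> borel_measurable (sample I)"
    and H: "\<And>x. x \<in> space (sample I) \<Longrightarrow> \<bar>H x\<bar> \<le> c"
  shows "integrable (sample I) (\<lambda>x. score i z x * H x)"
proof -
  interpret N: prob_space "sample I" by (rule prob_space_sample)
  note [measurable] = measurable_score[OF assms(1,2)] assms(3)
  show ?thesis
  proof (rule N.integrable_const_bound[where B="K * c"])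
    show "AE x in sample I. norm (score i z x * H x) \<le> K * c"
      using mult_mono[OF abs_score[OF assms(2)] H] K_ge_1 by (intro AE_I2) (simp add: abs_mult)
  qed simp
qed

lemma expectation_total_score_mult:
  assumes "i \<in> I" "H \<in> borel_measurable (sample I)" "\<And>x. x \<in> space (sample I) \<Longrightarrow> \<bar>H x\<bar> \<le> c"
  shows "(\<integral>x. total_score i x * H x \<partial>sample I) = (\<Sum>z\<in>Z. \<integral>x. score i z x * H x \<partial>sample I)"
  unfolding total_score_def sum_distrib_right
  using assms by (intro Bochner_Integration.integral_sum integrable_score_mult)

text \<open>Given the other points, the score of \<open>i\<close> in a cell \<open>z\<close> is centred, so it suffices that moving point \<open>i\<close>
between the spots of a shielded cell \<open>z\<close> does not change the score of \<open>k\<close>. In \<open>z\<close> itself, the score of \<open>k\<close>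
vanishes because point \<open>k\<close> is either outside \<open>z\<close> or in a shield. In any other cell, point \<open>i\<close> stays
outside that cell.\<close>

lemma total_score_orthogonal:
  assumes "i \<in> I" "k \<in> I" "i \<noteq> k"
  shows "(\<integral>x. total_score i x * total_score k x \<partial>sample I) = 0"
proof -
  have same: "score k z' (x(i := y')) = score k z' (x(i := y))"
    if z: "z \<in> Z" "z' \<in> Z" and sh: "shielded (I - {i}) z x" and y: "y \<in> Bp z" "y' \<in> Bm z" for x y y' z z'
  proof (cases "z' = z")
    case True
    have "swap_sign z (x k) = 0"
    proof (cases "x k \<in> Q z")
      case True
      then obtain t where "t < m" "x k \<in> W z t" using sh assms by (auto simp: shielded_def)
      then show ?thesis using swap_sign_shield z by blast
    qed (use swap_sign_outside z in blast)
    then show ?thesis using True assms by (simp add: score_def)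
  next
    case False
    then have "Q z \<inter> Q z' = {}" using cells_disjoint z by (auto simp: disjoint_family_on_def)
    then have out: "y \<notin> Q z'" "y' \<notin> Q z'"
      using subsetD[OF swap_in_cell(1)[OF z(1)] y(1)] subsetD[OF swap_in_cell(2)[OF z(1)] y(2)] by auto
    have "((x(i := y')) j \<in> Q z') = ((x(i := y)) j \<in> Q z')" for j using out by simp
    moreover have "((x(i := y')) j \<in> W z' t) = ((x(i := y)) j \<in> W z' t)" if "t < m" for j t
      using out shield_in_cell[OF z(2) that] by auto
    ultimately have "shielded (I - {k}) z' (x(i := y')) = shielded (I - {k}) z' (x(i := y))"
      unfolding shielded_def by (simp del: fun_upd_apply cong: conj_cong)
    then show ?thesis using assms by (simp add: score_def)
  qed
  have "(\<integral>x. total_score i x * total_score k x \<partial>sample I) =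
      (\<Sum>z\<in>Z. \<integral>x. score i z x * total_score k x \<partial>sample I)"
    using assms by (intro expectation_total_score_mult[where c=K] measurable_total_score abs_total_score)
  also have "\<dots> = 0"
    using assms same by (intro sum.neutral ballI expectation_score_eq_0[where c=K] measurable_total_score abs_total_score)
      (auto simp: total_score_def intro!: sum.cong)
  finally show ?thesis .
qed

text \<open>The test statistic is the sum of the scores over all indices and cells. Orthogonality bounds its second
moment by \<open>card I * K\<^sup>2\<close>, and every pair of an index and a cell contributes at least \<open>b * \<Delta> * r\<close> to its
covariance with \<open>F\<close>.\<close>

lemma variance_ge:
  assumes F: "F \<in> borel_measurable (sample I)" "\<And>x. x \<in> space (sample I) \<Longrightarrow> \<bar>F x\<bar> \<le> c"
    and gap: "\<And>i z x y y'. i \<in> I \<Longrightarrow> z \<in> Z \<Longrightarrow> x \<in> space (sample (I - {i})) \<Longrightarrow>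
      shielded (I - {i}) z x \<Longrightarrow> y \<in> Bp z \<Longrightarrow> y' \<in> Bm z \<Longrightarrow> F (x(i := y')) + \<Delta> \<le> F (x(i := y))"
    and b: "\<And>z. z \<in> Z \<Longrightarrow> b \<le> measure \<mu> (Bp z)" "0 \<le> b" and \<Delta>: "0 \<le> \<Delta>"
    and r: "\<And>i z. i \<in> I \<Longrightarrow> z \<in> Z \<Longrightarrow>
      r \<le> measure (sample (I - {i})) {x\<in>space (sample (I - {i})). shielded (I - {i}) z x}" "0 \<le> r"
    and "I \<noteq> {}"
  shows "(real (card I) * (real (card Z) * (b * \<Delta> * r)))\<^sup>2 / (real (card I) * K\<^sup>2)
    \<le> prob_space.variance (sample I) F"
proof -
  interpret N: prob_space "sample I" by (rule prob_space_sample)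
  define G where "G x = (\<Sum>i\<in>I. total_score i x)" for x
  note [measurable] = measurable_total_score
  have intT: "integrable (sample I) (\<lambda>x. total_score i x * H x)"
    if "i \<in> I" and [measurable]: "H \<in> borel_measurable (sample I)"
      and H: "\<And>x. x \<in> space (sample I) \<Longrightarrow> \<bar>H x\<bar> \<le> e" for i H e
  proof (rule N.integrable_const_bound[where B="K * e"])
    show "AE x in sample I. norm (total_score i x * H x) \<le> K * e"
      using mult_mono[OF abs_total_score H] K_ge_1 by (intro AE_I2) (simp add: abs_mult)
  qed (use that in measurable)
  have mean: "(\<integral>x. total_score i x \<partial>sample I) = 0" if "i \<in> I" for i
  proof -
    have "(\<integral>x. total_score i x * 1 \<partial>sample I) = (\<Sum>z\<in>Z. \<integral>x. score i z x * 1 \<partial>sample I)"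
      using that by (intro expectation_total_score_mult[where c=1]) auto
    also have "\<dots> = 0" using that by (intro sum.neutral ballI expectation_score_eq_0[where c=1]) auto
    finally show ?thesis by simp
  qed
  have sq: "(\<integral>x. total_score i x * total_score i x \<partial>sample I) \<le> K\<^sup>2" if "i \<in> I" for i
  proof -
    have "(\<integral>x. total_score i x * total_score i x \<partial>sample I) \<le> (\<integral>x. K\<^sup>2 \<partial>sample I)"
    proof (rule integral_mono)
      show "total_score i x * total_score i x \<le> K\<^sup>2" for x
        using power_mono[OF abs_total_score[of i x] abs_ge_zero, of 2] by (simp add: power2_eq_square)
    qed (use that intT[of i "total_score i" K] abs_total_score in auto)
    then show ?thesis by (simp add: N.prob_space)
  qed
  show ?thesis
  proof (rule N.variance_ge_covariance_test[OF F(1) _ F(2), of G "real (card I) * K"])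
    show "G \<in> borel_measurable (sample I)" unfolding G_def by measurable
    show "\<bar>G x\<bar> \<le> real (card I) * K" for x
      unfolding G_def by (rule order_trans[OF sum_abs sum_bounded_above]) (rule abs_total_score)
    have iT: "integrable (sample I) (total_score i)" if "i \<in> I" for i
      using intT[of i "\<lambda>_. 1" 1] that by simp
    show "N.expectation G = 0"
      unfolding G_def by (subst Bochner_Integration.integral_sum) (auto simp: iT mean)
    have "N.expectation (\<lambda>x. (G x)\<^sup>2) =
        (\<Sum>i\<in>I. \<Sum>k\<in>I. (\<integral>x. total_score i x * total_score k x \<partial>sample I))"
      unfolding G_def power2_eq_square sum_product
      by (subst Bochner_Integration.integral_sum,
          auto intro!: Bochner_Integration.integrable_sum intT abs_total_score sum.cong Bochner_Integration.integral_sum)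
    also have "\<dots> = (\<Sum>i\<in>I. (\<integral>x. total_score i x * total_score i x \<partial>sample I))"
    proof (rule sum.cong[OF refl])
      fix i assume i: "i \<in> I"
      have "(\<Sum>k\<in>I - {i}. (\<integral>x. total_score i x * total_score k x \<partial>sample I)) = 0"
        using total_score_orthogonal i by (intro sum.neutral) auto
      then show "(\<Sum>k\<in>I. (\<integral>x. total_score i x * total_score k x \<partial>sample I)) =
          (\<integral>x. total_score i x * total_score i x \<partial>sample I)"
        using i finite_I by (simp add: sum.remove)
    qed
    also have "\<dots> \<le> real (card I) * K\<^sup>2" by (rule sum_bounded_above) (rule sq)
    finally show "N.expectation (\<lambda>x. (G x)\<^sup>2) \<le> real (card I) * K\<^sup>2" .
    show "0 < real (card I) * K\<^sup>2" using finite_I \<open>I \<noteq> {}\<close> K_ge_1 by (simp add: card_gt_0_iff)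
    show "0 \<le> real (card I) * (real (card Z) * (b * \<Delta> * r))" using b(2) \<Delta> r(2) by simp
    have "real (card I) * (real (card Z) * (b * \<Delta> * r)) = (\<Sum>i\<in>I. \<Sum>z\<in>Z. b * \<Delta> * r)" by simp
    also have "\<dots> \<le> (\<Sum>i\<in>I. \<Sum>z\<in>Z. \<integral>x. score i z x * F x \<partial>sample I)"
    proof (intro sum_mono)
      fix i z assume iz: "i \<in> I" "z \<in> Z"
      have "b * \<Delta> * r \<le> measure \<mu> (Bp z) * \<Delta> *
          measure (sample (I - {i})) {x\<in>space (sample (I - {i})). shielded (I - {i}) z x}"
        using b(1)[OF iz(2)] b(2) \<Delta> r(1)[OF iz] r(2) by (intro mult_mono mult_nonneg_nonneg) auto
      also have "\<dots> \<le> (\<integral>x. score i z x * F x \<partial>sample I)"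
        using iz F gap by (intro expectation_score_ge[where c=c])
      finally show "b * \<Delta> * r \<le> (\<integral>x. score i z x * F x \<partial>sample I)" .
    qed
    also have "\<dots> = (\<Sum>i\<in>I. \<integral>x. total_score i x * F x \<partial>sample I)"
      using F by (intro sum.cong refl expectation_total_score_mult[symmetric])
    also have "\<dots> = N.expectation (\<lambda>x. G x * F x)"
      unfolding G_def sum_distrib_right using F by (intro Bochner_Integration.integral_sum[symmetric] intT)
    finally show "real (card I) * (real (card Z) * (b * \<Delta> * r)) \<le> N.expectation (\<lambda>x. G x * F x)" .
  qed
qed

end

section \<open>The geometry of a shielded cell\<close>

lemma mult_ge_near:
  fixes a b :: real
  assumes "\<bar>a - a0\<bar> \<le> e" "\<bar>b - b0\<bar> \<le> f"
  shows "a0 * b0 - \<bar>a0\<bar> * f - \<bar>b0\<bar> * e - e * f \<le> a * b"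
proof -
  have "a * b = a0 * b0 + a0 * (b - b0) + b0 * (a - a0) + (a - a0) * (b - b0)"
    by (simp add: algebra_simps)
  moreover have "\<bar>a0 * (b - b0)\<bar> \<le> \<bar>a0\<bar> * f" "\<bar>b0 * (a - a0)\<bar> \<le> \<bar>b0\<bar> * e"
    "\<bar>(a - a0) * (b - b0)\<bar> \<le> e * f"
    unfolding abs_mult using assms by (auto intro!: mult_left_mono mult_mono)
  ultimately show ?thesis by linarith
qed

text \<open>With \<open>y\<close> at the origin, the point \<open>u\<close> is closer to both \<open>y\<close> and \<open>v\<close> than these are to each other.\<close>

definition lune :: "real \<Rightarrow> real \<Rightarrow> real \<Rightarrow> real \<Rightarrow> bool" where
  "lune u1 u2 v1 v2 \<longleftrightarrow> u1\<^sup>2 + u2\<^sup>2 < v1\<^sup>2 + v2\<^sup>2 \<and> (v1 - u1)\<^sup>2 + (v2 - u2)\<^sup>2 < v1\<^sup>2 + v2\<^sup>2"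

lemma luneI:
  assumes "u1\<^sup>2 + u2\<^sup>2 < v1\<^sup>2 + v2\<^sup>2" "0 < u1 * (2 * v1 - u1) + u2 * (2 * v2 - u2)"
  shows "lune u1 u2 v1 v2"
  using assms by (simp add: lune_def power2_eq_square algebra_simps)

lemma lune_reflect: "lune u1 (- u2) v1 (- v2) = lune u1 u2 v1 v2"
  by (simp add: lune_def power2_eq_square algebra_simps)

lemma square_le_near:
  fixes a :: real
  assumes "\<bar>a - a0\<bar> \<le> e"
  shows "a\<^sup>2 \<le> (\<bar>a0\<bar> + e)\<^sup>2"
  using assms by (intro power2_le_iff_abs_le[THEN iffD2]) auto

lemma square_ge_near:
  fixes a :: real
  assumes "\<bar>a - a0\<bar> \<le> e" "e \<le> \<bar>a0\<bar>"
  shows "(\<bar>a0\<bar> - e)\<^sup>2 \<le> a\<^sup>2"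
  unfolding abs_le_square_iff[symmetric] using assms by linarith

text \<open>The five shield centres \<open>(2, 0)\<close>, \<open>(2, 4)\<close>, \<open>(2, -4)\<close>, \<open>(-4, 5)\<close>, \<open>(-4, -5)\<close> form two arms, mirror images in
the first axis, that start at \<open>(2, 0)\<close> and move away from the origin. Each centre lies in the lune of the
origin and the next one on its arm. The tolerance \<open>1/50\<close> is the sum of the half-sides \<open>1/100\<close> of the spot and
of the shield.\<close>

lemma lune_first:
  assumes "\<bar>u1 - 2\<bar> \<le> 1/50" "\<bar>u2\<bar> \<le> 1/50" "\<bar>v1 - 2\<bar> \<le> 1/50" "\<bar>v2 - 4\<bar> \<le> 1/50"
  shows "lune u1 u2 v1 v2"
proof (rule luneI)
  show "u1\<^sup>2 + u2\<^sup>2 < v1\<^sup>2 + v2\<^sup>2"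
    using square_le_near[of u1 2 "1/50"] square_le_near[of u2 0 "1/50"] 
      square_ge_near[of v1 2 "1/50"] square_ge_near[of v2 4 "1/50"] assms
    by (simp add: power2_eq_square)
  have "\<bar>2 * v1 - u1 - 2\<bar> \<le> 3/50" "\<bar>2 * v2 - u2 - 8\<bar> \<le> 3/50" using assms by linarith+
  then show "0 < u1 * (2 * v1 - u1) + u2 * (2 * v2 - u2)"
    using mult_ge_near[of u1 2 "1/50" "2 * v1 - u1" 2 "3/50"]
      mult_ge_near[of u2 0 "1/50" "2 * v2 - u2" 8 "3/50"] assms by simp
qed

lemma lune_second:
  assumes "\<bar>u1 - 2\<bar> \<le> 1/50" "\<bar>u2 - 4\<bar> \<le> 1/50" "\<bar>v1 + 4\<bar> \<le> 1/50" "\<bar>v2 - 5\<bar> \<le> 1/50"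
  shows "lune u1 u2 v1 v2"
proof (rule luneI)
  show "u1\<^sup>2 + u2\<^sup>2 < v1\<^sup>2 + v2\<^sup>2"
    using square_le_near[of u1 2 "1/50"] square_le_near[of u2 4 "1/50"] 
      square_ge_near[of v1 "-4" "1/50"] square_ge_near[of v2 5 "1/50"] assms
    by (simp add: power2_eq_square)
  have "\<bar>2 * v1 - u1 - (- 10)\<bar> \<le> 3/50" "\<bar>2 * v2 - u2 - 6\<bar> \<le> 3/50" using assms by linarith+
  then show "0 < u1 * (2 * v1 - u1) + u2 * (2 * v2 - u2)"
    using mult_ge_near[of u1 2 "1/50" "2 * v1 - u1" "-10" "3/50"]
      mult_ge_near[of u2 4 "1/50" "2 * v2 - u2" 6 "3/50"] assms by simp
qed

lemma far_norm:
  assumes "9 \<le> \<bar>v1\<bar> \<or> 9 \<le> \<bar>v2 :: real\<bar>"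
  shows "81 \<le> v1\<^sup>2 + v2\<^sup>2"
proof -
  have "81 \<le> v\<^sup>2" if "9 \<le> \<bar>v\<bar>" for v :: real using power_mono[OF that, of 2] by simp
  then show ?thesis using assms zero_le_power2[of v1] zero_le_power2[of v2] by (metis add_increasing add_increasing2)
qed

text \<open>For points far from the origin, the plane is covered by five regions, each served by one shield: a cone
around the positive first axis, the rest of the two quadrants on the right, and the two quadrants on the left.\<close>

lemma lune_far_right:
  assumes "\<bar>u1 - 2\<bar> \<le> 1/50" "\<bar>u2\<bar> \<le> 1/50" and v: "\<bar>v2\<bar> \<le> v1" "9 \<le> v1"
  shows "lune u1 u2 v1 v2"
proof (rule luneI)
  have s: "u1\<^sup>2 \<le> 5" "u2\<^sup>2 \<le> 1"
    using square_le_near[of u1 2 "1/50"] square_le_near[of u2 0 "1/50"] assms by (simp_all add: power2_eq_square)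
  then show "u1\<^sup>2 + u2\<^sup>2 < v1\<^sup>2 + v2\<^sup>2" using far_norm[of v1 v2] v by auto
  have "1 \<le> u1" using assms by linarith
  then have "1 * v1 \<le> u1 * v1" using v by (intro mult_right_mono) auto
  moreover have "\<bar>u2 * v2\<bar> \<le> 1/50 * v1" unfolding abs_mult using assms by (intro mult_mono) auto
  then have "- (1/50 * v1) \<le> u2 * v2" by linarith
  moreover have "u1 * (2 * v1 - u1) + u2 * (2 * v2 - u2) = 2 * (u1 * v1) + 2 * (u2 * v2) - u1\<^sup>2 - u2\<^sup>2"
    by (simp add: algebra_simps power2_eq_square)
  ultimately show "0 < u1 * (2 * v1 - u1) + u2 * (2 * v2 - u2)" using s v by linarith
qed

lemma lune_far_upper:
  assumes "\<bar>u1 - 2\<bar> \<le> 1/50" "\<bar>u2 - 4\<bar> \<le> 1/50" and v: "0 \<le> v1" "9 \<le> v2"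
  shows "lune u1 u2 v1 v2"
proof (rule luneI)
  have s: "u1\<^sup>2 \<le> 5" "u2\<^sup>2 \<le> 17"
    using square_le_near[of u1 2 "1/50"] square_le_near[of u2 4 "1/50"] assms by (simp_all add: power2_eq_square)
  then show "u1\<^sup>2 + u2\<^sup>2 < v1\<^sup>2 + v2\<^sup>2" using far_norm[of v1 v2] v by auto
  have u: "0 \<le> u1" "3 \<le> u2" using assms by linarith+
  have "0 \<le> u1 * v1" using u v by simp
  moreover have "3 * 9 \<le> u2 * v2" using u v by (intro mult_mono) auto
  ultimately show "0 < u1 * (2 * v1 - u1) + u2 * (2 * v2 - u2)"
    using s by (simp add: algebra_simps power2_eq_square)
qed

lemma lune_far_left:
  assumes "\<bar>u1 + 4\<bar> \<le> 1/50" "\<bar>u2 - 5\<bar> \<le> 1/50" and v: "v1 \<le> 0" "0 \<le> v2" "v1 \<le> - 9 \<or> 9 \<le> v2"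
  shows "lune u1 u2 v1 v2"
proof (rule luneI)
  have s: "u1\<^sup>2 \<le> 17" "u2\<^sup>2 \<le> 26"
    using square_le_near[of u1 "-4" "1/50"] square_le_near[of u2 5 "1/50"] assms by (simp_all add: power2_eq_square)
  then show "u1\<^sup>2 + u2\<^sup>2 < v1\<^sup>2 + v2\<^sup>2" using far_norm[of v1 v2] v by auto
  have "3 \<le> - u1" "3 \<le> u2" using assms by linarith+
  then have "3 * (- v1) \<le> (- u1) * (- v1)" "3 * v2 \<le> u2 * v2"
    using v by (intro mult_right_mono; simp)+
  moreover have "9 \<le> - v1 + v2" using v by linarith
  ultimately show "0 < u1 * (2 * v1 - u1) + u2 * (2 * v2 - u2)"
    using s v by (simp add: algebra_simps power2_eq_square)
qed

text \<open>The axis-parallel square with centre \<open>z + r * p\<close> and half-side \<open>r * e\<close>.\<close>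

definition box_at :: "real \<Rightarrow> real^2 \<Rightarrow> real \<times> real \<Rightarrow> real \<Rightarrow> (real^2) set" where
  "box_at r z p e = cbox (\<chi> i. z $ i + r * ((if i = 1 then fst p else snd p) - e))
                        (\<chi> i. z $ i + r * ((if i = 1 then fst p else snd p) + e))"

definition shield_centre :: "nat \<Rightarrow> real \<times> real" where
  "shield_centre t = [(2, 0), (2, 4), (2, - 4), (- 4, 5), (- 4, - 5)] ! t"

abbreviation cell :: "real \<Rightarrow> real^2 \<Rightarrow> (real^2) set" where
  "cell r z \<equiv> box_at r z (0, 0) 10"

abbreviation shield :: "real \<Rightarrow> real^2 \<Rightarrow> nat \<Rightarrow> (real^2) set" where
  "shield r z t \<equiv> box_at r z (shield_centre t) (1/100)"

abbreviation far_spot :: "real \<Rightarrow> real^2 \<Rightarrow> (real^2) set" where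
  "far_spot r z \<equiv> box_at r z (0, 0) (1/100)"

abbreviation near_spot :: "real \<Rightarrow> real^2 \<Rightarrow> (real^2) set" where
  "near_spot r z \<equiv> box_at r z (2, 1) (1/100)"

lemma mem_box_at:
  assumes "0 < r"
  shows "v \<in> box_at r z p e \<longleftrightarrow>
    \<bar>(v $ 1 - z $ 1) / r - fst p\<bar> \<le> e \<and> \<bar>(v $ 2 - z $ 2) / r - snd p\<bar> \<le> e"
proof -
  have "(\<bar>(a - b) / r - q\<bar> \<le> e) = (b + r * (q - e) \<le> a \<and> a \<le> b + r * (q + e))" for a b q
    using assms by (simp add: abs_le_iff field_simps) linarith
  then show ?thesis by (auto simp: box_at_def mem_box_cart forall_2)
qed

lemma dist_scaled:
  fixes u v z :: "real^2"
  assumes "0 < r"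
  shows "dist u v = r * sqrt (((u $ 1 - z $ 1) / r - (v $ 1 - z $ 1) / r)\<^sup>2 +
                             ((u $ 2 - z $ 2) / r - (v $ 2 - z $ 2) / r)\<^sup>2)"
proof -
  have "((u $ i - z $ i) / r - (v $ i - z $ i) / r)\<^sup>2 = (u $ i - v $ i)\<^sup>2 / r\<^sup>2" for i
    by (simp add: diff_divide_distrib[symmetric] power_divide)
  then have "sqrt (((u $ 1 - z $ 1) / r - (v $ 1 - z $ 1) / r)\<^sup>2 +
      ((u $ 2 - z $ 2) / r - (v $ 2 - z $ 2) / r)\<^sup>2) = sqrt ((u $ 1 - v $ 1)\<^sup>2 + (u $ 2 - v $ 2)\<^sup>2) / r"
    using assms by (simp add: add_divide_distrib[symmetric] real_sqrt_divide)
  then show ?thesis using assms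
    by (simp add: dist_vec_def L2_set_def sum_2 dist_real_def)
qed

lemma dist_lune:
  fixes u v y z :: "real^2"
  assumes r: "0 < r" and "lune ((u $ 1 - z $ 1) / r - (y $ 1 - z $ 1) / r) ((u $ 2 - z $ 2) / r - (y $ 2 - z $ 2) / r)
     ((v $ 1 - z $ 1) / r - (y $ 1 - z $ 1) / r) ((v $ 2 - z $ 2) / r - (y $ 2 - z $ 2) / r)"
  shows "dist y u < dist y v" "dist u v < dist y v"
proof -
  have "dist u y < dist v y" "dist v u < dist v y"
    using assms(2) r unfolding lune_def dist_scaled[OF r, of u y z] dist_scaled[OF r, of v y z] dist_scaled[OF r, of v u z]
    by simp_all
  then show "dist y u < dist y v" "dist u v < dist y v" by (simp_all add: dist_commute)
qed

lemma shield_offset: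
  assumes r: "0 < r" and "y \<in> far_spot r z" "u \<in> shield r z s"
  shows "\<bar>(u $ 1 - z $ 1) / r - (y $ 1 - z $ 1) / r - fst (shield_centre s)\<bar> \<le> 1/50"
    "\<bar>(u $ 2 - z $ 2) / r - (y $ 2 - z $ 2) / r - snd (shield_centre s)\<bar> \<le> 1/50"
proof -
  have *: "\<bar>a - b - p\<bar> \<le> 1/50" if "\<bar>a - p\<bar> \<le> 1/100" "\<bar>b - 0\<bar> \<le> 1/100" for a b p :: real
    using that by linarith
  show "\<bar>(u $ 1 - z $ 1) / r - (y $ 1 - z $ 1) / r - fst (shield_centre s)\<bar> \<le> 1/50"
    "\<bar>(u $ 2 - z $ 2) / r - (y $ 2 - z $ 2) / r - snd (shield_centre s)\<bar> \<le> 1/50"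
    using assms(2,3) unfolding mem_box_at[OF r] fst_conv snd_conv by (blast intro: *)+
qed

lemma shield_centre_simps:
  "shield_centre 0 = (2, 0)" "shield_centre 1 = (2, 4)" "shield_centre (Suc 0) = (2, 4)"
  "shield_centre 2 = (2, - 4)" "shield_centre 3 = (- 4, 5)" "shield_centre 4 = (- 4, - 5)"
  by (simp_all add: shield_centre_def)

lemma abs_neg_offset: "\<bar>(a::real) + p\<bar> \<le> e \<Longrightarrow> \<bar>- a - p\<bar> \<le> e"
  by linarith

text \<open>A point of a later shield is never a tree neighbour of a point in the far spot: the preceding shield on its
arm lies in their lune.\<close>

lemma shield_lune_near:
  assumes r: "0 < r" and y: "y \<in> far_spot r z" and t: "1 \<le> t" "t < 5" and v: "v \<in> shield r z t"
  shows "\<exists>s<5. \<forall>u\<in>shield r z s. dist y u < dist y v \<and> dist u v < dist y v"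
proof -
  define a where "a w = (w $ 1 - z $ 1) / r - (y $ 1 - z $ 1) / r" for w :: "real^2"
  define b where "b w = (w $ 2 - z $ 2) / r - (y $ 2 - z $ 2) / r" for w :: "real^2"
  have off: "\<bar>a u - fst (shield_centre s)\<bar> \<le> 1/50" "\<bar>b u - snd (shield_centre s)\<bar> \<le> 1/50"
    if "u \<in> shield r z s" for u s
    using shield_offset[OF r y that] unfolding a_def b_def .
  have reduce: ?thesis if "s < 5" "\<And>u. u \<in> shield r z s \<Longrightarrow> lune (a u) (b u) (a v) (b v)" for s
    using that dist_lune[OF r, of _ z y v] unfolding a_def b_def by blast
  consider "t = 1" | "t = 2" | "t = 3" | "t = 4" using t by linarith
  then show ?thesis
  proof cases
    case 1
    show ?thesis
    proof (rule reduce[of 0])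
      fix u assume u: "u \<in> shield r z 0"
      show "lune (a u) (b u) (a v) (b v)"
        using off[OF u] off[OF v] unfolding 1 shield_centre_simps by (intro lune_first) simp_all
    qed simp
  next
    case 2
    show ?thesis
    proof (rule reduce[of 0])
      fix u assume u: "u \<in> shield r z 0"
      have "lune (a u) (- b u) (a v) (- b v)"
        using off[OF u] off[OF v] unfolding 2 shield_centre_simps
        by (intro lune_first abs_neg_offset) simp_all
      then show "lune (a u) (b u) (a v) (b v)" by (simp add: lune_reflect)
    qed simp
  next
    case 3
    show ?thesis
    proof (rule reduce[of 1])
      fix u assume u: "u \<in> shield r z 1"
      show "lune (a u) (b u) (a v) (b v)"
        using off[OF u] off[OF v] unfolding 3 shield_centre_simps by (intro lune_second) simp_all
    qed simp
  next
    case 4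
    show ?thesis
    proof (rule reduce[of 2])
      fix u assume u: "u \<in> shield r z 2"
      have "lune (a u) (- b u) (a v) (- b v)"
        using off[OF u] off[OF v] unfolding 4 shield_centre_simps
        by (intro lune_second abs_neg_offset) simp_all
      then show "lune (a u) (b u) (a v) (b v)" by (simp add: lune_reflect)
    qed simp
  qed
qed

text \<open>Outside the cell, some coordinate exceeds \<open>10 * r\<close> relative to the centre, which is large compared with the
distances of the shields, so a shield in roughly the same direction lies in the lune.\<close>

lemma shield_lune_far:
  assumes r: "0 < r" and y: "y \<in> far_spot r z" and v: "v \<notin> cell r z"
  shows "\<exists>s<5. \<forall>u\<in>shield r z s. dist y u < dist y v \<and> dist u v < dist y v"
proof -
  define a where "a w = (w $ 1 - z $ 1) / r - (y $ 1 - z $ 1) / r" for w :: "real^2"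
  define b where "b w = (w $ 2 - z $ 2) / r - (y $ 2 - z $ 2) / r" for w :: "real^2"
  have off: "\<bar>a u - fst (shield_centre s)\<bar> \<le> 1/50" "\<bar>b u - snd (shield_centre s)\<bar> \<le> 1/50"
    if "u \<in> shield r z s" for u s
    using shield_offset[OF r y that] unfolding a_def b_def .
  have reduce: ?thesis if "s < 5" "\<And>u. u \<in> shield r z s \<Longrightarrow> lune (a u) (b u) (a v) (b v)" for s
    using that dist_lune[OF r, of _ z y v] unfolding a_def b_def by blast
  have far: "9 \<le> \<bar>a v\<bar> \<or> 9 \<le> \<bar>b v\<bar>"
  proof -
    have *: "9 \<le> \<bar>p - q\<bar>" if "\<not> \<bar>p - 0\<bar> \<le> 10" "\<bar>q - 0\<bar> \<le> 1/100" for p q :: real using that by linarith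
    show ?thesis using v y unfolding mem_box_at[OF r] a_def b_def fst_conv snd_conv de_Morgan_conj
      by (blast intro: *)
  qed
  consider "\<bar>b v\<bar> \<le> a v" | "0 \<le> a v" "a v < b v" | "0 \<le> a v" "a v < - b v"
    | "a v < 0" "0 \<le> b v" | "a v < 0" "b v < 0" by linarith
  then show ?thesis
  proof cases
    case 1
    show ?thesis
    proof (rule reduce[of 0])
      fix u assume u: "u \<in> shield r z 0"
      have "9 \<le> a v" using far 1 by linarith
      then show "lune (a u) (b u) (a v) (b v)"
        using off[OF u] 1 unfolding shield_centre_simps by (intro lune_far_right) simp_all
    qed simp
  next
    case 2
    show ?thesis
    proof (rule reduce[of 1])
      fix u assume u: "u \<in> shield r z 1"
      have "9 \<le> b v" using far 2 by linarith
      then show "lune (a u) (b u) (a v) (b v)"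
        using off[OF u] 2 unfolding shield_centre_simps by (intro lune_far_upper) simp_all
    qed simp
  next
    case 3
    show ?thesis
    proof (rule reduce[of 2])
      fix u assume u: "u \<in> shield r z 2"
      have "9 \<le> - b v" using far 3 by linarith
      then have "lune (a u) (- b u) (a v) (- b v)"
        using off[OF u] 3 unfolding shield_centre_simps by (intro lune_far_upper abs_neg_offset) simp_all
      then show "lune (a u) (b u) (a v) (b v)" by (simp add: lune_reflect)
    qed simp
  next
    case 4
    show ?thesis
    proof (rule reduce[of 3])
      fix u assume u: "u \<in> shield r z 3"
      have "a v \<le> - 9 \<or> 9 \<le> b v" using far 4 by linarith
      then show "lune (a u) (b u) (a v) (b v)"
        using off[OF u] 4 unfolding shield_centre_simps by (intro lune_far_left) simp_all
    qed simp
  next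
    case 5
    show ?thesis
    proof (rule reduce[of 4])
      fix u assume u: "u \<in> shield r z 4"
      have "a v \<le> - 9 \<or> 9 \<le> - b v" using far 5 by linarith
      then have "lune (a u) (- b u) (a v) (- b v)"
        using off[OF u] 5 unfolding shield_centre_simps by (intro lune_far_left abs_neg_offset) simp_all
      then show "lune (a u) (b u) (a v) (b v)" by (simp add: lune_reflect)
    qed simp
  qed
qed

lemma far_spot_dist:
  assumes r: "0 < r" and "y \<in> far_spot r z" "u \<in> shield r z 0"
  shows "19/10 * r \<le> dist u y"
proof -
  have "19/10 \<le> (u $ 1 - z $ 1) / r - (y $ 1 - z $ 1) / r"
    using assms(2,3) unfolding mem_box_at[OF r] shield_centre_def nth_Cons_0 fst_conv snd_conv by linarith
  then have "r * (19/10) \<le> u $ 1 - y $ 1" using r by (simp add: field_simps)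
  also have "\<dots> \<le> dist u y" using component_le_norm_cart[of "u - y" 1] by (simp add: dist_norm)
  finally show ?thesis by simp
qed

lemma near_spot_dist:
  assumes r: "0 < r" and "y \<in> near_spot r z" "u \<in> shield r z 0"
  shows "dist u y \<le> 11/10 * r"
proof -
  have *: "\<bar>(a - c) / r - p\<bar> \<le> 1/100 \<Longrightarrow> \<bar>(b - c) / r - q\<bar> \<le> 1/100 \<Longrightarrow> \<bar>p - q\<bar> + 1/50 \<le> d \<Longrightarrow> \<bar>a - b\<bar> \<le> r * d"
    for a b c d p q
  proof -
    assume "\<bar>(a - c) / r - p\<bar> \<le> 1/100" "\<bar>(b - c) / r - q\<bar> \<le> 1/100" "\<bar>p - q\<bar> + 1/50 \<le> d"
    then have "\<bar>(a - c) / r - (b - c) / r\<bar> \<le> d" by linarith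
    also have "(a - c) / r - (b - c) / r = (a - b) / r" by (simp add: diff_divide_distrib)
    finally show "\<bar>a - b\<bar> \<le> r * d" using r by (simp add: pos_divide_le_eq mult.commute)
  qed
  have "\<bar>u $ 1 - y $ 1\<bar> \<le> r * (1/50)"
    using assms(2,3) unfolding mem_box_at[OF r] shield_centre_simps fst_conv snd_conv by (elim conjE) (erule (1) *, simp)
  moreover have "\<bar>u $ 2 - y $ 2\<bar> \<le> r * (51/50)"
    using assms(2,3) unfolding mem_box_at[OF r] shield_centre_simps fst_conv snd_conv by (elim conjE) (erule (1) *, linarith)
  moreover have "dist u y \<le> \<bar>u $ 1 - y $ 1\<bar> + \<bar>u $ 2 - y $ 2\<bar>"
    using norm_le_l1_cart[of "u - y"] by (simp add: dist_norm sum_2)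
  ultimately show ?thesis using r by linarith
qed

lemma box_at_mono:
  assumes r: "0 < r" and "\<bar>fst p\<bar> + e \<le> 10" "\<bar>snd p\<bar> + e \<le> 10"
  shows "box_at r z p e \<subseteq> cell r z"
proof -
  have *: "\<bar>x - 0\<bar> \<le> 10" if "\<bar>x - q\<bar> \<le> e" "\<bar>q\<bar> + e \<le> 10" for x q :: real using that by linarith
  show ?thesis unfolding subset_iff mem_box_at[OF r] fst_conv snd_conv using assms(2,3) by (blast intro: *)
qed

lemma box_at_disjoint:
  assumes r: "0 < r" and "2 * e < \<bar>fst p - fst q\<bar> \<or> 2 * e < \<bar>snd p - snd q\<bar>"
  shows "box_at r z p e \<inter> box_at r z q e = {}"
proof -
  have *: False if "\<bar>x - p\<bar> \<le> e" "\<bar>x - q\<bar> \<le> e" "2 * e < \<bar>p - q\<bar>" for x p q :: real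
    using that by linarith
  show ?thesis unfolding set_eq_iff Int_iff mem_box_at[OF r] empty_iff using assms(2) by (blast dest: *)
qed

lemma less_5_cases: "t < 5 \<Longrightarrow> t = 0 \<or> t = 1 \<or> t = 2 \<or> t = 3 \<or> t = (4::nat)"
  by linarith

lemma shield_subset_cell: "0 < r \<Longrightarrow> t < 5 \<Longrightarrow> shield r z t \<subseteq> cell r z"
  by (rule box_at_mono) (auto dest!: less_5_cases simp: shield_centre_simps)

lemma spot_subset_cell: "0 < r \<Longrightarrow> far_spot r z \<subseteq> cell r z" "0 < r \<Longrightarrow> near_spot r z \<subseteq> cell r z"
  by (rule box_at_mono; simp)+

lemma spots_disjoint:
  assumes "0 < r"
  shows "far_spot r z \<inter> near_spot r z = {}"
    "t < 5 \<Longrightarrow> shield r z t \<inter> (far_spot r z \<union> near_spot r z) = {}"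
proof -
  show "far_spot r z \<inter> near_spot r z = {}" using assms by (intro box_at_disjoint) auto
  assume t: "t < 5"
  have "shield r z t \<inter> far_spot r z = {}"
    using assms less_5_cases[OF t] by (intro box_at_disjoint) (auto simp: shield_centre_simps)
  moreover have "shield r z t \<inter> near_spot r z = {}"
    using assms less_5_cases[OF t] by (intro box_at_disjoint) (auto simp: shield_centre_simps)
  ultimately show "shield r z t \<inter> (far_spot r z \<union> near_spot r z) = {}" by blast
qed

lemma measure_box_at:
  assumes "0 < r" "0 \<le> e"
  shows "emeasure lborel (box_at r z p e) = ennreal ((2 * r * e)\<^sup>2)"
proof -
  have ne: "box_at r z p e \<noteq> {}" using assms unfolding box_at_def interval_ne_empty_cart by auto
  have "measure lborel (box_at r z p e) = (2 * r * e)\<^sup>2"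
    using ne unfolding box_at_def
    by (subst content_cbox_cart) (auto simp: prod_2 UNIV_2 power2_eq_square algebra_simps)
  moreover have "emeasure lborel (box_at r z p e) \<noteq> top"
    unfolding box_at_def by (rule less_imp_neq[OF emeasure_lborel_cbox_finite[unfolded infinity_ennreal_def]])
  ultimately show ?thesis by (simp add: emeasure_eq_ennreal_measure)
qed

text \<open>A square of arbitrary orientation with side \<open>s\<close> contains the disc of radius \<open>s / 2\<close> around its centre and
thus an axis-parallel square of side \<open>s / 2\<close>. Coordinates with respect to the sides are obtained by inner
products, and the columns of the matrix with the orthogonal rows \<open>u\<close> and \<open>v\<close> of equal length are orthogonal as
well.\<close>

lemma square_contains_box:
  assumes "is_square S s"
  obtains c :: "real^2" where "\<And>w. \<bar>w $ 1 - c $ 1\<bar> \<le> s / 4 \<Longrightarrow> \<bar>w $ 2 - c $ 2\<bar> \<le> s / 4 \<Longrightarrow> w \<in> S"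
proof -
  from assms obtain a u v where s: "s > 0" and uv: "norm u = s" "norm v = s" "u \<bullet> v = 0"
    and S: "S = {a + x *\<^sub>R u + y *\<^sub>R v | x y. x \<in> {0..1} \<and> y \<in> {0..1}}"
    by (auto simp: is_square_def)
  define c where "c = a + (1/2) *\<^sub>R u + (1/2) *\<^sub>R v"
  have n: "(u $ 1)\<^sup>2 + (u $ 2)\<^sup>2 = s\<^sup>2" "(v $ 1)\<^sup>2 + (v $ 2)\<^sup>2 = s\<^sup>2" "u $ 1 * v $ 1 + u $ 2 * v $ 2 = 0"
    using uv s by (auto simp: norm_vec_def L2_set_def sum_2 inner_vec_def real_sqrt_eq_iff)
  define D where "D = u $ 1 * v $ 2 - u $ 2 * v $ 1"
  have v: "s\<^sup>2 * v $ 1 = - (u $ 2 * D)" "s\<^sup>2 * v $ 2 = u $ 1 * D"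
    unfolding n(1)[symmetric] D_def using n(3) by algebra+
  have D2: "D\<^sup>2 = s\<^sup>2 * s\<^sup>2" unfolding D_def using n by algebra
  have ortho: "(u $ 1)\<^sup>2 + (v $ 1)\<^sup>2 = s\<^sup>2" "(u $ 2)\<^sup>2 + (v $ 2)\<^sup>2 = s\<^sup>2" "u $ 1 * u $ 2 + v $ 1 * v $ 2 = 0"
  proof -
    have "s\<^sup>2 * s\<^sup>2 * (v $ 1)\<^sup>2 = s\<^sup>2 * s\<^sup>2 * (u $ 2)\<^sup>2" "s\<^sup>2 * s\<^sup>2 * (v $ 2)\<^sup>2 = s\<^sup>2 * s\<^sup>2 * (u $ 1)\<^sup>2"
      "s\<^sup>2 * s\<^sup>2 * (v $ 1 * v $ 2) = s\<^sup>2 * s\<^sup>2 * (- (u $ 1 * u $ 2))"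
      using v D2 by algebra+
    moreover have "s\<^sup>2 * s\<^sup>2 \<noteq> 0" using s by simp
    ultimately have "(v $ 1)\<^sup>2 = (u $ 2)\<^sup>2" "(v $ 2)\<^sup>2 = (u $ 1)\<^sup>2" "v $ 1 * v $ 2 = - (u $ 1 * u $ 2)"
      using mult_left_cancel by blast+
    then show "(u $ 1)\<^sup>2 + (v $ 1)\<^sup>2 = s\<^sup>2" "(u $ 2)\<^sup>2 + (v $ 2)\<^sup>2 = s\<^sup>2" "u $ 1 * u $ 2 + v $ 1 * v $ 2 = 0"
      using n by simp_all
  qed
  have "w \<in> S" if w: "\<bar>w $ 1 - c $ 1\<bar> \<le> s / 4" "\<bar>w $ 2 - c $ 2\<bar> \<le> s / 4" for w
  proof -
    define d where "d = w - c"
    define x y where "x = (d \<bullet> u) / s\<^sup>2" and "y = (d \<bullet> v) / s\<^sup>2"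
    have nd: "norm d \<le> s / 2"
      using norm_le_l1_cart[of d] w by (simp add: sum_2 d_def)
    have inner: "\<bar>d \<bullet> e\<bar> \<le> s / 2 * s" if "norm e = s" for e
      using order_trans[OF Cauchy_Schwarz_ineq2[of d e] mult_right_mono[OF nd norm_ge_zero[of e]]]
      unfolding that .
    have half: "\<bar>e / s\<^sup>2\<bar> \<le> 1/2" if "\<bar>e\<bar> \<le> s / 2 * s" for e :: real
    proof -
      have "\<bar>e\<bar> \<le> 1/2 * s\<^sup>2" using that by (simp add: power2_eq_square)
      moreover have "0 < s\<^sup>2" using s by simp
      ultimately have "\<bar>e\<bar> / s\<^sup>2 \<le> 1/2" by (subst pos_divide_le_eq)
      then show ?thesis by (simp only: abs_divide abs_power2)
    qed
    have xy: "\<bar>x\<bar> \<le> 1/2" "\<bar>y\<bar> \<le> 1/2"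
      unfolding x_def y_def by (rule half[OF inner[OF uv(1)]], rule half[OF inner[OF uv(2)]])
    have "(d \<bullet> u) * u $ 1 + (d \<bullet> v) * v $ 1 =
        d $ 1 * ((u $ 1)\<^sup>2 + (v $ 1)\<^sup>2) + d $ 2 * (u $ 1 * u $ 2 + v $ 1 * v $ 2)"
      unfolding inner_vec_def sum_2 inner_real_def by (simp add: power2_eq_square algebra_simps)
    moreover have "(d \<bullet> u) * u $ 2 + (d \<bullet> v) * v $ 2 =
        d $ 2 * ((u $ 2)\<^sup>2 + (v $ 2)\<^sup>2) + d $ 1 * (u $ 1 * u $ 2 + v $ 1 * v $ 2)"
      unfolding inner_vec_def sum_2 inner_real_def by (simp add: power2_eq_square algebra_simps)
    ultimately have "d $ 1 * s\<^sup>2 = (d \<bullet> u) * u $ 1 + (d \<bullet> v) * v $ 1"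
      "d $ 2 * s\<^sup>2 = (d \<bullet> u) * u $ 2 + (d \<bullet> v) * v $ 2"
      unfolding ortho by simp_all
    moreover have "x * u $ i + y * v $ i = ((d \<bullet> u) * u $ i + (d \<bullet> v) * v $ i) / s\<^sup>2" for i
      by (simp add: x_def y_def add_divide_distrib)
    ultimately have "x * u $ i + y * v $ i = d $ i" for i
      using s exhaust_2[of i] by (metis nonzero_mult_div_cancel_right power_not_zero less_irrefl)
    then have "d = x *\<^sub>R u + y *\<^sub>R v" by (simp add: vec_eq_iff)
    then have "w = c + (x *\<^sub>R u + y *\<^sub>R v)" unfolding d_def by (simp add: diff_eq_eq add.commute)
    then have "w = a + (1/2 + x) *\<^sub>R u + (1/2 + y) *\<^sub>R v"
      unfolding c_def by (simp add: scaleR_add_left)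
    moreover have "1/2 + x \<in> {0..1}" "1/2 + y \<in> {0..1}"
      using xy unfolding abs_le_iff by auto
    ultimately show ?thesis unfolding S by blast
  qed
  then show thesis using that by blast
qed

section \<open>Minimal spanning trees of point configurations\<close>

lemma admissible_weight_bounds:
  assumes "admissible_weight c1 c2 h" "u \<in> unit_square" "v \<in> unit_square"
  shows "0 \<le> h u v" "h u v = h v u" "h u v \<le> c2 * dist u v"
  using assms unfolding admissible_weight_def by blast+

lemma edge_weight_pair:
  assumes "admissible_weight c1 c2 h" "x i \<in> unit_square" "x k \<in> unit_square"
  shows "edge_weight h \<alpha> x {i, k} = h (x i) (x k) powr \<alpha>"
  using admissible_weight_bounds(2)[OF assms] unfolding edge_weight_def
  by (cases "i \<le> k") (simp_all add: min_def max_def)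

lemma complete_edgesE:
  assumes "e \<in> complete_edges V"
  obtains i k where "e = {i, k}" "i \<in> V" "k \<in> V" "i \<noteq> k"
  using assms by (auto simp: complete_edges_def card_2_iff)

lemma edge_weight_cong:
  assumes "e \<in> complete_edges V" "\<And>k. k \<in> e \<Longrightarrow> x k = x' k"
  shows "edge_weight h \<alpha> x e = edge_weight h \<alpha> x' e"
proof -
  from assms(1) have "finite e" "e \<noteq> {}"
    by (auto simp: complete_edges_def intro: card_ge_0_finite)
  then show ?thesis using assms(2) Min_in Max_in by (simp add: edge_weight_def)
qed

lemma MST_cong:
  assumes "\<And>k. k \<in> {1..n} \<Longrightarrow> x k = x' k"
  shows "MST h \<alpha> n x = MST h \<alpha> n x'"
proof -
  have "sum (edge_weight h \<alpha> x) T = sum (edge_weight h \<alpha> x') T" if T: "T \<in> spanning_trees {1..n}" for T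
  proof (rule sum.cong[OF refl])
    fix e assume "e \<in> T"
    then have e: "e \<in> complete_edges {1..n}" using T unfolding spanning_trees_def by blast
    moreover have "e \<subseteq> {1..n}" using e unfolding complete_edges_def by blast
    ultimately show "edge_weight h \<alpha> x e = edge_weight h \<alpha> x' e" using assms by (intro edge_weight_cong) auto
  qed
  then show ?thesis unfolding MST_def by (simp cong: image_cong)
qed

text \<open>Take a minimal spanning tree for the configuration with vertex \<open>i\<close> at \<open>y\<close>. By the lune property, \<open>i\<close> is
adjacent only to vertices in \<open>A\<close>, and it has at least one neighbour. The same edges connect the configuration
with \<open>i\<close> at \<open>y'\<close>, and each edge at \<open>i\<close> becomes cheaper by at least \<open>l powr \<alpha> - l' powr \<alpha>\<close>.\<close>

lemma MST_swap_ge: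
  fixes x :: "nat \<Rightarrow> real^2"
  assumes adm: "admissible_weight c1 c2 h" and "0 < \<alpha>" and S: "S \<subseteq> unit_square"
    and h: "\<And>u v. u \<in> unit_square \<Longrightarrow> v \<in> unit_square \<Longrightarrow> u \<in> S \<or> v \<in> S \<Longrightarrow> h u v = dist u v"
    and x: "\<And>k. k \<in> {1..n} - {i} \<Longrightarrow> x k \<in> unit_square" and i: "i \<in> {1..n}"
    and y: "y \<in> S" "y' \<in> S" and l: "0 \<le> l'" "l' \<le> l"
    and A: "A \<subseteq> {1..n} - {i}" "A \<noteq> {}"
    and near: "\<And>k. k \<in> A \<Longrightarrow> l \<le> dist (x k) y" "\<And>k. k \<in> A \<Longrightarrow> dist (x k) y' \<le> l'"
    and lune: "\<And>v. v \<in> {1..n} - {i} - A \<Longrightarrow> \<exists>u\<in>{1..n} - {i}. x u \<in> S \<and>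
        dist y (x u) < dist y (x v) \<and> dist (x u) (x v) < dist y (x v)"
  shows "MST h \<alpha> n (x(i := y')) + (l powr \<alpha> - l' powr \<alpha>) \<le> MST h \<alpha> n (x(i := y))"
proof -
  let ?V = "{1..n}"
  let ?w = "edge_weight h \<alpha> (x(i := y))" and ?w' = "edge_weight h \<alpha> (x(i := y'))"
  have fin: "finite ?V" by simp
  have sq: "(x(i := p)) k \<in> unit_square" if "k \<in> ?V" "p \<in> S" for k p
    using x S that by auto
  have w_dist: "edge_weight h \<alpha> (x(i := p)) {k, k'} = dist ((x(i := p)) k) ((x(i := p)) k') powr \<alpha>"
    if "k \<in> ?V" "k' \<in> ?V" "p \<in> S" "(x(i := p)) k \<in> S" for k k' p
    using edge_weight_pair[OF adm sq[OF that(1,3)] sq[OF that(2,3)], of \<alpha>]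
      h[OF sq[OF that(1,3)] sq[OF that(2,3)]] that(4)
    by (simp del: fun_upd_apply)
  have nonneg: "0 \<le> edge_weight h \<alpha> z e" for z e by (simp add: edge_weight_def)
  have "Min (sum ?w ` spanning_trees ?V) \<in> sum ?w ` spanning_trees ?V"
    by (intro Min_in finite_imageI finite_spanning_trees) (simp_all add: spanning_trees_nonempty)
  then obtain T where T: "T \<in> spanning_trees ?V" and min: "sum ?w T = Min (sum ?w ` spanning_trees ?V)" by auto
  have TV: "T \<subseteq> complete_edges ?V" and conn: "edges_connected ?V T"
    using T unfolding spanning_trees_def by blast+
  have finT: "finite T" by (rule finite_subset[OF TV finite_complete_edges[OF fin]])
  have attached: "\<exists>k\<in>A. e = {i, k}" if e: "e \<in> T" "i \<in> e" for e
  proof -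
    from e TV have "e \<in> complete_edges ?V" by blast
    then obtain a b where ab: "e = {a, b}" "a \<in> ?V" "b \<in> ?V" "a \<noteq> b" by (rule complete_edgesE)
    then obtain v where v: "e = {i, v}" "v \<in> ?V - {i}" using e(2) by (auto simp: insert_commute)
    have "v \<in> A"
    proof (rule ccontr)
      assume "v \<notin> A"
      then have "v \<in> ?V - {i} - A" using v by blast
      from lune[OF this] obtain u where u: "u \<in> ?V - {i}" "x u \<in> S"
        "dist y (x u) < dist y (x v)" "dist (x u) (x v) < dist y (x v)" by blast
      have "{i, v} \<notin> T"
      proof (rule minimal_spanning_tree_lune[OF fin i _ _ T min])
        show "u \<in> ?V" "v \<in> ?V" "u \<noteq> i" using u v by auto
        show "u \<noteq> v" using u(3) by auto
        have "?w {i, v} = dist y (x v) powr \<alpha>" using w_dist[of i v y] v i y by auto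
        moreover have "?w {u, i} = dist y (x u) powr \<alpha>"
          using w_dist[of u i y] u i y by (auto simp: dist_commute)
        moreover have "?w {u, v} = dist (x u) (x v) powr \<alpha>" using w_dist[of u v y] u v y by auto
        ultimately show "?w {u, i} < ?w {i, v}" "?w {u, v} < ?w {i, v}"
          using u \<open>0 < \<alpha>\<close> by (simp_all add: powr_less_mono2)
      qed (rule nonneg)
      then show False using v e by simp
    qed
    then show ?thesis using v by blast
  qed
  let ?E = "{e \<in> T. i \<in> e}"
  have lower: "l powr \<alpha> \<le> ?w e" and upper: "?w' e \<le> l' powr \<alpha>" if "e \<in> ?E" for e
  proof -
    from that attached obtain k where k: "k \<in> A" "e = {i, k}" by blast
    then have kV: "k \<in> ?V" "k \<noteq> i" using A by auto
    have "?w e = dist (x k) y powr \<alpha>" using w_dist[of i k y] k kV i y by (auto simp: dist_commute)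
    then show "l powr \<alpha> \<le> ?w e" using near(1)[OF k(1)] l \<open>0 < \<alpha>\<close> by (simp add: powr_mono2)
    have "?w' e = dist (x k) y' powr \<alpha>" using w_dist[of i k y'] k kV i y by (auto simp: dist_commute)
    then show "?w' e \<le> l' powr \<alpha>" using near(2)[OF k(1)] \<open>0 < \<alpha>\<close> by (simp add: powr_mono2)
  qed
  have rest: "?w e = ?w' e" if "e \<in> T - ?E" for e
    using that TV by (intro edge_weight_cong[of _ ?V]) auto
  obtain k where k: "k \<in> A" using A by blast
  then have "\<exists>e\<in>T. i \<in> e" using A by (intro spanning_tree_meets_vertex[OF T i, of k]) auto
  then have card: "1 \<le> card ?E" using finT by (simp add: Suc_le_eq card_gt_0_iff) blast
  have "l powr \<alpha> - l' powr \<alpha> \<le> real (card ?E) * (l powr \<alpha> - l' powr \<alpha>)"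
    using mult_right_mono[of 1 "real (card ?E)" "l powr \<alpha> - l' powr \<alpha>"] card l \<open>0 < \<alpha>\<close>
    by (simp add: powr_mono2)
  also have "\<dots> \<le> (\<Sum>e\<in>?E. ?w e - ?w' e)"
    using lower upper by (intro sum_bounded_below) (simp add: diff_mono)
  finally have E: "l powr \<alpha> - l' powr \<alpha> \<le> sum ?w ?E - sum ?w' ?E" by (simp add: sum_subtractf)
  have split: "sum g T = sum g ?E + sum g (T - ?E)" for g :: "nat set \<Rightarrow> real"
    using finT by (subst sum.subset_diff[of ?E]) auto
  have "MST h \<alpha> n (x(i := y')) \<le> sum ?w' T"
    unfolding MST_def by (rule Min_spanning_trees_le_connected[OF fin TV conn nonneg])
  also have "\<dots> = sum ?w' ?E + sum ?w (T - ?E)" unfolding split[of ?w'] using rest by simp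
  also have "\<dots> \<le> sum ?w T - (l powr \<alpha> - l' powr \<alpha>)" using E unfolding split[of ?w] by simp
  finally show ?thesis unfolding MST_def min by simp
qed

lemma MST_bounds:
  assumes adm: "admissible_weight c1 c2 h" and "0 < \<alpha>" "0 < c2"
  shows "\<exists>c. \<forall>x. (\<forall>k\<in>{1..n}. x k \<in> unit_square) \<longrightarrow> \<bar>MST h \<alpha> n x\<bar> \<le> c"
proof -
  obtain D where D: "\<And>u v. u \<in> unit_square \<Longrightarrow> v \<in> unit_square \<Longrightarrow> dist u v \<le> D"
    using bounded_cbox[of 0 "1::real^2"] unfolding unit_square_def bounded_two_points by blast
  define B where "B = (c2 * D) powr \<alpha>"
  have "\<bar>MST h \<alpha> n x\<bar> \<le> real (card (complete_edges {1..n})) * B" if x: "\<forall>k\<in>{1..n}. x k \<in> unit_square" for x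
  proof -
    have e: "edge_weight h \<alpha> x e \<le> B" if "e \<in> complete_edges {1..n}" for e
    proof -
      from that obtain i k where ik: "e = {i, k}" "i \<in> {1..n}" "k \<in> {1..n}" by (rule complete_edgesE)
      then have sq: "x i \<in> unit_square" "x k \<in> unit_square" using x by auto
      have "h (x i) (x k) \<le> c2 * D"
        by (rule order_trans[OF admissible_weight_bounds(3)[OF adm sq] mult_left_mono[OF D[OF sq]]])
           (use \<open>0 < c2\<close> in simp)
      then show ?thesis unfolding ik B_def edge_weight_pair[OF adm sq]
        using admissible_weight_bounds(1)[OF adm sq] \<open>0 < \<alpha>\<close> by (intro powr_mono2) auto
    qed
    have "MST h \<alpha> n x \<le> sum (edge_weight h \<alpha> x) (complete_edges {1..n})"
      unfolding MST_def
      by (rule Min_spanning_trees_le_connected) (auto simp: complete_edges_connected edge_weight_def)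
    also have "\<dots> \<le> real (card (complete_edges {1..n})) * B" by (rule sum_bounded_above[OF e])
    finally have "MST h \<alpha> n x \<le> real (card (complete_edges {1..n})) * B" .
    moreover have "0 \<le> MST h \<alpha> n x"
      unfolding MST_def by (subst Min_ge_iff)
        (auto simp: finite_spanning_trees spanning_trees_nonempty edge_weight_def intro!: sum_nonneg)
    ultimately show ?thesis by simp
  qed
  then show ?thesis by blast
qed

lemma measurable_MST:
  assumes adm: "admissible_weight c1 c2 h" and \<mu>: "sets \<mu> = sets (restrict_space borel unit_square)"
  shows "MST h \<alpha> n \<in> borel_measurable (PiM {1..n} (\<lambda>_. \<mu>))"
proof -
  let ?N = "PiM {1..n} (\<lambda>_. \<mu>)" and ?S = "restrict_space borel unit_square :: (real^2) measure"
  have hm: "(\<lambda>(x, y). h x y) \<in> borel_measurable (?S \<Otimes>\<^sub>M ?S)"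
    using adm unfolding admissible_weight_def by blast
  have comp: "(\<lambda>x. x k) \<in> ?N \<rightarrow>\<^sub>M ?S" if "k \<in> {1..n}" for k
    using measurable_component_singleton[OF that, of "\<lambda>_. \<mu>"] measurable_cong_sets[OF refl \<mu>] by blast
  have edge: "(\<lambda>x. edge_weight h \<alpha> x e) \<in> borel_measurable ?N" if "e \<in> complete_edges {1..n}" for e
  proof -
    have e: "finite e" "e \<noteq> {}" "e \<subseteq> {1..n}" using that
      by (auto simp: complete_edges_def intro: card_ge_0_finite)
    then have "Min e \<in> {1..n}" "Max e \<in> {1..n}" using Min_in Max_in by blast+
    then have "(\<lambda>x. (x (Min e), x (Max e))) \<in> ?N \<rightarrow>\<^sub>M ?S \<Otimes>\<^sub>M ?S" by (intro measurable_Pair comp)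
    from measurable_compose[OF this hm] show ?thesis unfolding edge_weight_def by simp
  qed
  have Min_meas: "(\<lambda>x. Min ((\<lambda>T. g T x) ` A)) \<in> borel_measurable ?N"
    if "finite A" "A \<noteq> {}" "\<And>T. T \<in> A \<Longrightarrow> g T \<in> borel_measurable ?N"
    for A :: "nat set set set" and g :: "nat set set \<Rightarrow> (nat \<Rightarrow> real^2) \<Rightarrow> real"
    using that
  proof (induction A rule: finite_ne_induct)
    case (insert T A)
    then show ?case by (simp add: borel_measurable_min)
  qed simp
  show ?thesis unfolding MST_def
  proof (rule Min_meas)
    fix T assume "T \<in> spanning_trees {1..n}"
    then have "T \<subseteq> complete_edges {1..n}" unfolding spanning_trees_def by blast
    then show "(\<lambda>x. sum (edge_weight h \<alpha> x) T) \<in> borel_measurable ?N"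
      by (intro borel_measurable_sum edge) auto
  qed (simp_all add: finite_spanning_trees spanning_trees_nonempty)
qed

lemma MST_shielded_swap:
  fixes x :: "nat \<Rightarrow> real^2"
  assumes adm: "admissible_weight c1 c2 h" and \<alpha>: "0 < \<alpha>" and S: "S \<subseteq> unit_square"
    and h: "\<And>u v. u \<in> unit_square \<Longrightarrow> v \<in> unit_square \<Longrightarrow> u \<in> S \<or> v \<in> S \<Longrightarrow> h u v = dist u v"
    and x: "\<And>k. k \<in> {1..n} - {i} \<Longrightarrow> x k \<in> unit_square" and i: "i \<in> {1..n}"
    and r: "0 < r" and cell: "cell r z \<subseteq> S"
    and inside: "\<And>k. k \<in> {1..n} - {i} \<Longrightarrow> x k \<in> cell r z \<Longrightarrow> \<exists>t<5. x k \<in> shield r z t"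
    and occupied: "\<And>t. t < 5 \<Longrightarrow> \<exists>k\<in>{1..n} - {i}. x k \<in> shield r z t"
    and y: "y \<in> far_spot r z" "y' \<in> near_spot r z"
  shows "MST h \<alpha> n (x(i := y')) + ((19/10 * r) powr \<alpha> - (11/10 * r) powr \<alpha>) \<le> MST h \<alpha> n (x(i := y))"
proof (rule MST_swap_ge[OF adm \<alpha> S h x i, where A = "{k \<in> {1..n} - {i}. x k \<in> shield r z 0}"])
  show "y \<in> S" "y' \<in> S" using y spot_subset_cell[OF r] cell by blast+
  show "0 \<le> 11/10 * r" "11/10 * r \<le> 19/10 * r" using r by simp_all
  show "{k \<in> {1..n} - {i}. x k \<in> shield r z 0} \<noteq> {}" using occupied[of 0] by auto
  fix v assume v: "v \<in> {1..n} - {i} - {k \<in> {1..n} - {i}. x k \<in> shield r z 0}"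
  have "\<exists>s<5. \<forall>u\<in>shield r z s. dist y u < dist y (x v) \<and> dist u (x v) < dist y (x v)"
  proof (cases "x v \<in> cell r z")
    case True
    then obtain t where t: "t < 5" "x v \<in> shield r z t" using inside v by blast
    then have "t \<noteq> 0" using v by (intro notI) auto
    then show ?thesis using shield_lune_near[OF r y(1) _ t] by simp
  next
    case False
    then show ?thesis by (rule shield_lune_far[OF r y(1)])
  qed
  then obtain s where s: "s < 5"
    "\<And>u. u \<in> shield r z s \<Longrightarrow> dist y u < dist y (x v) \<and> dist u (x v) < dist y (x v)" by blast
  obtain k where "k \<in> {1..n} - {i}" "x k \<in> shield r z s" using occupied[OF s(1)] by blast
  then show "\<exists>u\<in>{1..n} - {i}. x u \<in> S \<and> dist y (x u) < dist y (x v) \<and> dist (x u) (x v) < dist y (x v)"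
    using s cell shield_subset_cell[OF r s(1)] by blast
qed (use far_spot_dist[OF r y(1)] near_spot_dist[OF r y(2)] in auto)

section \<open>Cells and their probabilities\<close>

text \<open>The grid of \<open>k\<^sup>2\<close> squares has spacing \<open>24 * r\<close>, whereas a cell has side \<open>20 * r\<close>, so the closed cells are
disjoint. The \<open>k\<close> squares in a row fill the side \<open>s / 2\<close> of the axis-parallel square, that is,
\<open>24 * r * k = s / 2\<close>.\<close>

lemma square_contains_grid_of_cells:
  assumes S: "is_square S s" and k: "1 \<le> k" and r: "r = s / (48 * real k)"
  obtains ctr :: "nat \<times> nat \<Rightarrow> real^2"
  where "\<And>z. z \<in> {..<k} \<times> {..<k} \<Longrightarrow> cell r (ctr z) \<subseteq> S"
    and "disjoint_family_on (\<lambda>z. cell r (ctr z)) ({..<k} \<times> {..<k})"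
proof -
  have "0 < s" using S by (simp add: is_square_def)
  then have r0: "0 < r" using r k by simp
  have s: "s = 48 * real k * r" using r k by simp
  obtain c :: "real^2" where c: "\<And>w. \<bar>w $ 1 - c $ 1\<bar> \<le> s / 4 \<Longrightarrow> \<bar>w $ 2 - c $ 2\<bar> \<le> s / 4 \<Longrightarrow> w \<in> S"
    using square_contains_box[OF S] by blast
  define off where "off j = (24 * real j + 12 - 12 * real k) * r" for j :: nat
  define ctr :: "nat \<times> nat \<Rightarrow> real^2" where "ctr z = (\<chi> m. c $ m + off (if m = 1 then fst z else snd z))" for z
  have ctr: "ctr z $ 1 = c $ 1 + off (fst z)" "ctr z $ 2 = c $ 2 + off (snd z)" for z
    by (simp_all add: ctr_def)
  have mem: "\<bar>w $ 1 - ctr z $ 1\<bar> \<le> 10 * r" "\<bar>w $ 2 - ctr z $ 2\<bar> \<le> 10 * r" if "w \<in> cell r (ctr z)" for w z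
    using that r0 unfolding mem_box_at[OF r0] by (auto simp: pos_divide_le_eq)
  have inside: "\<bar>a - b\<bar> \<le> s / 4" if a: "\<bar>a - (b + off j)\<bar> \<le> 10 * r" and j: "j < k" for a b j
  proof -
    have "real j + 1 \<le> real k" using j by linarith
    then have "\<bar>24 * real j + 12 - 12 * real k\<bar> \<le> 12 * real k - 12" by linarith
    from mult_right_mono[OF this, of r] have "\<bar>off j\<bar> \<le> (12 * real k - 12) * r"
      using r0 by (simp add: off_def abs_mult)
    also have "\<dots> = s / 4 - 12 * r" unfolding s by (simp add: algebra_simps)
    finally have "\<bar>off j\<bar> \<le> s / 4 - 12 * r" .
    then show ?thesis using a r0 by linarith
  qed
  have same: "j = j'" if "\<bar>a - (b + off j)\<bar> \<le> 10 * r" "\<bar>a - (b + off j')\<bar> \<le> 10 * r" for a b j j'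
  proof -
    have "\<bar>off j - off j'\<bar> \<le> 20 * r" using that by linarith
    also have "off j - off j' = 24 * (real j - real j') * r" by (simp add: off_def algebra_simps)
    finally have "24 * \<bar>real j - real j'\<bar> \<le> 20" using r0 by (simp add: abs_mult)
    then have "\<bar>real j - real j'\<bar> < 1" by simp
    then have "real j < real (Suc j')" "real j' < real (Suc j)" by (simp_all add: abs_less_iff)
    then show ?thesis unfolding of_nat_less_iff by simp
  qed
  show thesis
  proof (rule that)
    show "cell r (ctr z) \<subseteq> S" if "z \<in> {..<k} \<times> {..<k}" for z
    proof
      fix w assume "w \<in> cell r (ctr z)"
      from mem[OF this] show "w \<in> S"
        unfolding ctr using that by (intro c inside) auto
    qed
    show "disjoint_family_on (\<lambda>z. cell r (ctr z)) ({..<k} \<times> {..<k})"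
      unfolding disjoint_family_on_def
    proof (intro ballI impI)
      fix z z' :: "nat \<times> nat" assume "z \<noteq> z'"
      show "cell r (ctr z) \<inter> cell r (ctr z') = {}"
      proof (rule ccontr)
        assume "cell r (ctr z) \<inter> cell r (ctr z') \<noteq> {}"
        then obtain w where w: "w \<in> cell r (ctr z)" "w \<in> cell r (ctr z')" by blast
        have "fst z = fst z'" by (rule same[of "w $ 1" "c $ 1"]) (use mem(1)[OF w(1)] mem(1)[OF w(2)] ctr in simp_all)
        moreover have "snd z = snd z'" by (rule same[of "w $ 2" "c $ 2"]) (use mem(2)[OF w(1)] mem(2)[OF w(2)] ctr in simp_all)
        ultimately show False using \<open>z \<noteq> z'\<close> by (simp add: prod_eq_iff)
      qed
    qed
  qed
qed

lemma measure_density_bounds: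
  fixes f :: "'a \<Rightarrow> real"
  assumes f: "(\<lambda>x. ennreal (f x)) \<in> borel_measurable L" and P: "prob_space (density L f)"
    and bounds: "\<And>x. x \<in> space L \<Longrightarrow> e1 \<le> f x \<and> f x \<le> e2" "0 \<le> e1" "0 \<le> a"
    and A: "A \<in> sets L" "emeasure L A = ennreal a"
  shows "e1 * a \<le> measure (density L f) A" "measure (density L f) A \<le> e2 * a"
proof -
  interpret prob_space "density L f" by (rule P)
  have e2: "0 \<le> e2 \<or> A = {}"
    using sets.sets_into_space[OF A(1)] bounds(1,2) by force
  have e: "ennreal (measure (density L f) A) = (\<integral>\<^sup>+x. ennreal (f x) * indicator A x \<partial>L)"
    using f A(1) by (simp add: emeasure_density flip: emeasure_eq_measure)
  have "ennreal (e1 * a) = (\<integral>\<^sup>+x. ennreal e1 * indicator A x \<partial>L)"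
    using A bounds by (simp add: nn_integral_cmult_indicator ennreal_mult)
  also have "\<dots> \<le> (\<integral>\<^sup>+x. ennreal (f x) * indicator A x \<partial>L)"
    using bounds by (intro nn_integral_mono mult_right_mono ennreal_leI) auto
  finally show "e1 * a \<le> measure (density L f) A" unfolding e[symmetric] by (simp add: ennreal_le_iff)
  have "(\<integral>\<^sup>+x. ennreal (f x) * indicator A x \<partial>L) \<le> (\<integral>\<^sup>+x. ennreal e2 * indicator A x \<partial>L)"
    using bounds by (intro nn_integral_mono mult_right_mono ennreal_leI) auto
  also have "\<dots> = ennreal e2 * ennreal a" using A by (simp add: nn_integral_cmult_indicator)
  finally have *: "ennreal (measure (density L f) A) \<le> ennreal e2 * ennreal a" unfolding e .
  show "measure (density L f) A \<le> e2 * a"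
  proof (cases "A = {}")
    case True
    then have "a = 0" using A(2) bounds(3) by simp
    then show ?thesis using True by simp
  next
    case False
    then have "0 \<le> e2" using e2 by simp
    then show ?thesis using * bounds(3) by (simp add: ennreal_mult'[symmetric] ennreal_le_iff)
  qed
qed

lemma exp_le_one_minus_power:
  fixes \<kappa> :: real
  assumes "0 \<le> \<kappa>" "2 * \<kappa> \<le> real n" "0 < n" "j \<le> n"
  shows "exp (- 2 * \<kappa>) \<le> (1 - \<kappa> / real n) ^ j"
proof -
  let ?x = "\<kappa> / real n"
  have x: "0 \<le> ?x" "?x \<le> 1/2" using assms by (auto simp: field_simps)
  have "?x * ?x \<le> ?x * (1/2)" using x by (intro mult_left_mono)
  then have "- 2 * ?x \<le> - ?x - 2 * ?x\<^sup>2" by (simp add: power2_eq_square)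
  also have "\<dots> \<le> ln (1 - ?x)" using x by (intro ln_one_minus_pos_lower_bound)
  finally have "exp (- 2 * ?x) \<le> exp (ln (1 - ?x))" by (simp only: exp_le_cancel_iff)
  then have "exp (- 2 * ?x) \<le> 1 - ?x" using x by simp
  then have "exp (- 2 * ?x) ^ n \<le> (1 - ?x) ^ n" by (rule power_mono) simp
  also have "exp (- 2 * ?x) ^ n = exp (- 2 * \<kappa>)" using assms by (simp flip: exp_of_nat_mult)
  also have "(1 - ?x) ^ n \<le> (1 - ?x) ^ j" using x assms by (intro power_decreasing) auto
  finally show ?thesis .
qed

lemma sqrt_floor_bounds:
  assumes "1 \<le> n" "k = nat \<lfloor>sqrt (real n)\<rfloor>"
  shows "1 \<le> k" "real k \<le> sqrt (real n)" "real n \<le> 4 * (real k * real k)"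
proof -
  have s: "1 \<le> sqrt (real n)" using assms by simp
  then show k: "1 \<le> k" unfolding assms(2) by (simp add: le_nat_iff le_floor_iff)
  show "real k \<le> sqrt (real n)" unfolding assms(2) using s by (simp add: of_nat_nat)
  have "sqrt (real n) < real k + 1" unfolding assms(2) using s by (simp add: of_nat_nat)
  then have "sqrt (real n) \<le> 2 * real k" using k by linarith
  then have "sqrt (real n) * sqrt (real n) \<le> (2 * real k) * (2 * real k)" by (intro mult_mono) auto
  then show "real n \<le> 4 * (real k * real k)" by simp
qed

section \<open>The variance of the minimal spanning tree\<close>

text \<open>The minimal weight depends only on the points with indices \<open>1, \<dots>, n\<close>, whose joint distribution is the
product of the common distribution with density \<open>f\<close>.\<close>

lemma (in prob_space) variance_MST_eq_PiM:
  assumes X: "iid_density f X" and n: "1 \<le> n" and adm: "admissible_weight c1 c2 h"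
  defines "\<mu> \<equiv> density (restrict_space lborel unit_square) (\<lambda>x. ennreal (f x))"
  shows "prob_space \<mu>" "(\<lambda>x. ennreal (f x)) \<in> borel_measurable (restrict_space lborel unit_square)"
    "variance (\<lambda>\<omega>. MST h \<alpha> n (\<lambda>i. X i \<omega>)) = prob_space.variance (PiM {1..n} (\<lambda>_. \<mu>)) (MST h \<alpha> n)"
proof -
  let ?L = "restrict_space lborel unit_square :: (real^2) measure"
  have ind: "indep_vars (\<lambda>_. ?L) X {1..}" and dis: "\<And>i. 1 \<le> i \<Longrightarrow> distributed M ?L (X i) (\<lambda>x. ennreal (f x))"
    using X unfolding iid_density_def by auto
  have meas: "X i \<in> M \<rightarrow>\<^sub>M ?L" if "1 \<le> i" for i using dis[OF that] by (rule distributed_measurable)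
  have \<mu>: "distr M ?L (X i) = \<mu>" if "1 \<le> i" for i
    using distributed_distr_eq_density[OF dis[OF that]] unfolding \<mu>_def .
  show P: "prob_space \<mu>" using prob_space_distr[OF meas[of 1]] \<mu>[of 1] by simp
  show "(\<lambda>x. ennreal (f x)) \<in> borel_measurable ?L"
    using distributed_borel_measurable[OF dis[of 1]] by simp
  let ?T = "\<lambda>\<omega>. \<lambda>i\<in>{1..n}. X i \<omega>"
  let ?N = "PiM {1..n} (\<lambda>_. \<mu>)"
  have "indep_vars (\<lambda>_. ?L) X {1..n}" by (rule indep_vars_subset[OF ind]) auto
  then have "distr M (PiM {1..n} (\<lambda>_. ?L)) ?T = PiM {1..n} (\<lambda>i. distr M ?L (X i))"
    using n meas by (subst (asm) indep_vars_iff_distr_eq_PiM') auto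
  also have "\<dots> = ?N" using \<mu> by (intro PiM_cong) auto
  finally have N: "distr M (PiM {1..n} (\<lambda>_. ?L)) ?T = ?N" .
  have sets: "sets \<mu> = sets (restrict_space borel unit_square)"
    unfolding \<mu>_def by (simp add: sets_restrict_space_cong[of lborel borel])
  have F: "MST h \<alpha> n \<in> borel_measurable (PiM {1..n} (\<lambda>_. ?L))"
    by (rule measurable_MST[OF adm]) (simp add: sets_restrict_space_cong[of lborel borel])
  have T: "?T \<in> M \<rightarrow>\<^sub>M PiM {1..n} (\<lambda>_. ?L)" using meas by (intro measurable_restrict) auto
  have eq: "MST h \<alpha> n (\<lambda>i. X i \<omega>) = MST h \<alpha> n (?T \<omega>)" for \<omega> by (rule MST_cong) simp
  have E: "(\<integral>x. g (MST h \<alpha> n x) \<partial>?N) = expectation (\<lambda>\<omega>. g (MST h \<alpha> n (\<lambda>i. X i \<omega>)))"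
    if g: "g \<in> borel_measurable borel" for g :: "real \<Rightarrow> real"
    unfolding eq N[symmetric] using measurable_compose[OF F g] by (rule integral_distr[OF T])
  show "variance (\<lambda>\<omega>. MST h \<alpha> n (\<lambda>i. X i \<omega>)) = prob_space.variance ?N (MST h \<alpha> n)"
    using E[of "\<lambda>t. t"] E[of "\<lambda>t. (t - integral\<^sup>L ?N (MST h \<alpha> n))\<^sup>2"] by simp
qed

text \<open>With \<open>k\<close> of order \<open>sqrt n\<close> cells per row, \<open>b0 / n\<close> is a lower bound for the probability of each spot and
each shield, \<open>e2 * s0\<^sup>2 / n\<close> is an upper bound for that of a cell, and \<open>\<rho>\<close> is a lower bound for the probability
that a cell is shielded. The number in \<open>b0\<close> is \<open>2500 * 2304\<close>: spots have area \<open>r\<^sup>2 / 2500\<close>, and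
\<open>r\<^sup>2\<close> is at least \<open>s0\<^sup>2 / (2304 * n)\<close>.\<close>

lemma variance_MST_ge:
  fixes h :: "real^2 \<Rightarrow> real^2 \<Rightarrow> real" and X :: "nat \<Rightarrow> 'a \<Rightarrow> real^2"
  assumes pos: "0 < \<alpha>" "0 < c2" "0 < e1" "e1 \<le> e2" "0 < s0"
    and P: "prob_space M" and X: "prob_space.iid_density M f X"
    and f: "\<And>x. x \<in> unit_square \<Longrightarrow> e1 \<le> f x \<and> f x \<le> e2"
    and adm: "admissible_weight c1 c2 h" and S: "is_square S s0" "S \<subseteq> unit_square"
    and h: "\<And>u v. u \<in> unit_square \<Longrightarrow> v \<in> unit_square \<Longrightarrow> u \<in> S \<or> v \<in> S \<Longrightarrow> h u v = dist u v"
    and n: "20 \<le> n" "2 * (e2 * s0\<^sup>2) \<le> real n"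
    and b0: "b0 = e1 * s0\<^sup>2 / 5760000"
    and \<rho>: "\<rho> = (b0 / 10) ^ 5 * exp (- 2 * (e2 * s0\<^sup>2))"
    and q: "q = b0 / 4 * ((19/10) powr \<alpha> - (11/10) powr \<alpha>) * (s0 / 48) powr \<alpha> * \<rho>"
  shows "q\<^sup>2 / (e2 / e1)\<^sup>2 * real n powr (1 - \<alpha>) \<le>
    prob_space.variance M (\<lambda>\<omega>. MST h \<alpha> n (\<lambda>i. X i \<omega>))"
proof -
  interpret M: prob_space M by (rule P)
  let ?L = "restrict_space lborel unit_square :: (real^2) measure"
  define \<mu> where "\<mu> = density ?L (\<lambda>x. ennreal (f x))"
  have n1: "1 \<le> n" using n by simp
  have var: "M.variance (\<lambda>\<omega>. MST h \<alpha> n (\<lambda>i. X i \<omega>)) = prob_space.variance (PiM {1..n} (\<lambda>_. \<mu>)) (MST h \<alpha> n)"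
    and fm: "(\<lambda>x. ennreal (f x)) \<in> borel_measurable ?L" and P\<mu>: "prob_space \<mu>"
    using M.variance_MST_eq_PiM[OF X n1 adm] unfolding \<mu>_def by blast+
  interpret \<mu>: prob_space \<mu> by (rule P\<mu>)
  define k where "k = nat \<lfloor>sqrt (real n)\<rfloor>"
  note k = sqrt_floor_bounds[OF n1 k_def]
  define r where "r = s0 / (48 * real k)"
  have r0: "0 < r" using pos k by (simp add: r_def)
  obtain ctr where ctr: "\<And>z. z \<in> {..<k} \<times> {..<k} \<Longrightarrow> cell r (ctr z) \<subseteq> S"
    and disj: "disjoint_family_on (\<lambda>z. cell r (ctr z)) ({..<k} \<times> {..<k})"
    using square_contains_grid_of_cells[OF S(1) k(1) r_def] by blast
  have k_sq: "real k * real k \<le> real n" using mult_mono[OF k(2) k(2)] by simp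
  have r_sq: "s0\<^sup>2 / (2304 * real n) \<le> r\<^sup>2" "r\<^sup>2 \<le> s0\<^sup>2 / (576 * real n)"
  proof -
    have rk: "r\<^sup>2 = s0\<^sup>2 / (2304 * (real k * real k))" by (simp add: r_def power2_eq_square)
    show "s0\<^sup>2 / (2304 * real n) \<le> r\<^sup>2" unfolding rk using k_sq k(1) n1 by (intro divide_left_mono mult_pos_pos) auto
    show "r\<^sup>2 \<le> s0\<^sup>2 / (576 * real n)" unfolding rk using k n1 by (intro divide_left_mono mult_pos_pos) auto
  qed
  have box: "box_at r (ctr z) p e \<in> sets \<mu>" "e1 * (2 * r * e)\<^sup>2 \<le> measure \<mu> (box_at r (ctr z) p e)"
    "measure \<mu> (box_at r (ctr z) p e) \<le> e2 * (2 * r * e)\<^sup>2"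
    if z: "z \<in> {..<k} \<times> {..<k}" and e: "0 \<le> e" and sub: "box_at r (ctr z) p e \<subseteq> cell r (ctr z)" for z p e
  proof -
    have US: "box_at r (ctr z) p e \<subseteq> unit_square" using sub ctr[OF z] S(2) by blast
    have us: "unit_square \<in> sets lborel" by (simp add: unit_square_def)
    have L: "box_at r (ctr z) p e \<in> sets ?L"
      using US us by (subst sets_restrict_space_iff) (auto simp: box_at_def)
    then show "box_at r (ctr z) p e \<in> sets \<mu>" by (simp add: \<mu>_def)
    have em: "emeasure ?L (box_at r (ctr z) p e) = ennreal ((2 * r * e)\<^sup>2)"
      using US us by (subst emeasure_restrict_space) (auto simp: measure_box_at[OF r0 e])
    have f': "e1 \<le> f x \<and> f x \<le> e2" if "x \<in> space ?L" for x
      using f that by (simp add: space_restrict_space)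
    have "0 \<le> e1" "0 \<le> (2 * r * e)\<^sup>2" using pos by simp_all
    from measure_density_bounds[OF fm P\<mu>[unfolded \<mu>_def] f' this L em]
    show "e1 * (2 * r * e)\<^sup>2 \<le> measure \<mu> (box_at r (ctr z) p e)"
      "measure \<mu> (box_at r (ctr z) p e) \<le> e2 * (2 * r * e)\<^sup>2"
      unfolding \<mu>_def by simp_all
  qed
  have small: "b0 / real n \<le> measure \<mu> (box_at r (ctr z) p (1/100))"
    if "z \<in> {..<k} \<times> {..<k}" "box_at r (ctr z) p (1/100) \<subseteq> cell r (ctr z)" for z p
  proof -
    have "b0 / real n = e1 / 2500 * (s0\<^sup>2 / (2304 * real n))" by (simp add: b0)
    also have "\<dots> \<le> e1 / 2500 * r\<^sup>2" using r_sq pos by (intro mult_left_mono) auto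
    also have "\<dots> = e1 * (2 * r * (1/100))\<^sup>2" by (simp add: power2_eq_square)
    also have "\<dots> \<le> measure \<mu> (box_at r (ctr z) p (1/100))" by (rule box(2)) (use that in auto)
    finally show ?thesis .
  qed
  have b0_pos: "0 < b0" using pos by (simp add: b0)
  interpret local_perturbation \<mu> "{1..n}" "{..<k} \<times> {..<k}" "\<lambda>z. cell r (ctr z)"
    "\<lambda>z. far_spot r (ctr z)" "\<lambda>z. near_spot r (ctr z)" "\<lambda>z t. shield r (ctr z) t" 5 "e2 / e1"
  proof
    fix z :: "nat \<times> nat" assume z: "z \<in> {..<k} \<times> {..<k}"
    note sp = spot_subset_cell[OF r0, of "ctr z"]
    show "cell r (ctr z) \<in> sets \<mu>" by (rule box(1)[OF z]) auto
    show "far_spot r (ctr z) \<in> sets \<mu>" "near_spot r (ctr z) \<in> sets \<mu>" by (rule box(1)[OF z _ sp(1)], simp, rule box(1)[OF z _ sp(2)], simp)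
    show "far_spot r (ctr z) \<subseteq> cell r (ctr z)" "near_spot r (ctr z) \<subseteq> cell r (ctr z)" by (rule sp)+
    show "far_spot r (ctr z) \<inter> near_spot r (ctr z) = {}" by (rule spots_disjoint(1)[OF r0])
    have "0 < b0 / real n" using b0_pos n1 by simp
    then show "0 < measure \<mu> (near_spot r (ctr z))" using small[OF z sp(2)] by linarith
    have "measure \<mu> (far_spot r (ctr z)) \<le> e2 * (2 * r * (1/100))\<^sup>2" by (rule box(3)[OF z _ sp(1)]) simp
    also have "\<dots> = e2 / e1 * (e1 * (2 * r * (1/100))\<^sup>2)" using pos by simp
    also have "\<dots> \<le> e2 / e1 * measure \<mu> (near_spot r (ctr z))"
      using pos by (intro mult_left_mono box(2)[OF z _ sp(2)]) auto
    finally show "measure \<mu> (far_spot r (ctr z)) \<le> e2 / e1 * measure \<mu> (near_spot r (ctr z))" .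
    fix t :: nat assume t: "t < 5"
    note sh = shield_subset_cell[OF r0 t, of "ctr z"]
    show "shield r (ctr z) t \<in> sets \<mu>" by (rule box(1)[OF z _ sh]) simp
    show "shield r (ctr z) t \<subseteq> cell r (ctr z)" by (rule sh)
    show "shield r (ctr z) t \<inter> (far_spot r (ctr z) \<union> near_spot r (ctr z)) = {}" by (rule spots_disjoint(2)[OF r0 t])
  qed (use pos disj in simp_all)
  have space_\<mu>: "space \<mu> = unit_square" by (simp add: \<mu>_def space_restrict_space)
  have in_square: "x j \<in> unit_square" if "x \<in> space (sample J)" "j \<in> J" for x J j
    using that unfolding space_PiM space_\<mu> by (rule PiE_mem)
  have \<mu>_sets: "sets \<mu> = sets (restrict_space borel unit_square)"
    unfolding \<mu>_def by (simp add: sets_restrict_space_cong[of lborel borel])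
  have F: "MST h \<alpha> n \<in> borel_measurable (sample {1..n})" by (rule measurable_MST[OF adm \<mu>_sets])
  obtain c where c: "\<And>x. (\<forall>k\<in>{1..n}. x k \<in> unit_square) \<Longrightarrow> \<bar>MST h \<alpha> n x\<bar> \<le> c"
    using MST_bounds[OF adm pos(1,2)] by blast
  define \<Delta> where "\<Delta> = (19/10 * r) powr \<alpha> - (11/10 * r) powr \<alpha>"
  define \<delta> where "\<delta> = (19/10) powr \<alpha> - (11/10 :: real) powr \<alpha>"
  have \<delta>: "0 \<le> \<delta>" unfolding \<delta>_def using pos by (simp add: powr_mono2)
  have scale: "(a * r) powr \<alpha> = r powr \<alpha> * a powr \<alpha>" if "0 < a" for a
    using that r0 by (simp add: powr_mult)
  have "(19/10 * r) powr \<alpha> = r powr \<alpha> * (19/10) powr \<alpha>" "(11/10 * r) powr \<alpha> = r powr \<alpha> * (11/10) powr \<alpha>"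
    by (rule scale, simp)+
  then have \<Delta>: "\<Delta> = r powr \<alpha> * \<delta>" unfolding \<Delta>_def \<delta>_def right_diff_distrib by (simp only:)
  have \<rho>0: "0 \<le> \<rho>" unfolding \<rho> using b0_pos by simp
  have ge: "(real (card {1..n}) * (real (card ({..<k} \<times> {..<k})) * (b0 / real n * \<Delta> * \<rho>)))\<^sup>2 /
      (real (card {1..n}) * (e2 / e1)\<^sup>2) \<le> prob_space.variance (sample {1..n}) (MST h \<alpha> n)"
  proof (rule variance_ge[OF F])
    fix x assume "x \<in> space (sample {1..n})"
    then show "\<bar>MST h \<alpha> n x\<bar> \<le> c" by (intro c ballI in_square)
  next
    fix i z x y y'
    assume i: "i \<in> {1..n}" and z: "z \<in> {..<k} \<times> {..<k}" and x: "x \<in> space (sample ({1..n} - {i}))"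
      and sh: "shielded ({1..n} - {i}) z x" and y: "y \<in> far_spot r (ctr z)" "y' \<in> near_spot r (ctr z)"
    show "MST h \<alpha> n (x(i := y')) + \<Delta> \<le> MST h \<alpha> n (x(i := y))"
      unfolding \<Delta>_def
    proof (rule MST_shielded_swap[OF adm pos(1) S(2) h _ i r0 ctr[OF z] _ _ y])
      show "x k \<in> unit_square" if "k \<in> {1..n} - {i}" for k
        using x that by (rule in_square)
      show "\<exists>t<5. x k \<in> shield r (ctr z) t" if "k \<in> {1..n} - {i}" "x k \<in> cell r (ctr z)" for k
        using sh that unfolding shielded_def by blast
      show "\<exists>k\<in>{1..n} - {i}. x k \<in> shield r (ctr z) t" if "t < 5" for t
        using sh that unfolding shielded_def by blast
    qed
  next
    fix z assume "z \<in> {..<k} \<times> {..<k}"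
    then show "b0 / real n \<le> measure \<mu> (far_spot r (ctr z))" by (intro small spot_subset_cell[OF r0])
  next
    show "0 \<le> b0 / real n" using b0_pos by simp
    show "0 \<le> \<Delta>" using \<Delta> \<delta> by simp
    show "0 \<le> \<rho>" by (rule \<rho>0)
    show "{1..n} \<noteq> {}" using n1 by simp
  next
    fix i z assume i: "i \<in> {1..n}" and z: "z \<in> {..<k} \<times> {..<k}"
    \<comment> \<open>Five blocks of consecutive indices, one per shield. Removing \<open>i\<close> costs at most one index of a block.\<close>
    define l where "l = n div 5"
    have l: "5 * l \<le> n" "real n / 10 \<le> real (l - 1)" using n(1) unfolding l_def by linarith+
    define B where "B t = {t * l + 1..(t + 1) * l} - {i}" for t
    have "(real (l - 1) * (b0 / real n)) ^ 5 * (1 - e2 * s0\<^sup>2 / real n) ^ card ({1..n} - {i}) \<le>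
        measure (sample ({1..n} - {i})) {x\<in>space (sample ({1..n} - {i})).
          (\<forall>k\<in>{1..n} - {i}. x k \<in> cell r (ctr z) \<longrightarrow> (\<exists>t<5. x k \<in> shield r (ctr z) t)) \<and>
          (\<forall>t<5. \<exists>k\<in>{1..n} - {i}. x k \<in> shield r (ctr z) t)}"
    proof (rule PiM_occupancy_lower_bound[where I = B])
      show "measure \<mu> (cell r (ctr z)) \<le> e2 * s0\<^sup>2 / real n"
      proof -
        have "measure \<mu> (cell r (ctr z)) \<le> e2 * (2 * r * 10)\<^sup>2" by (rule box(3)[OF z]) auto
        also have "\<dots> = e2 * 400 * r\<^sup>2" by (simp add: power2_eq_square)
        also have "\<dots> \<le> e2 * 400 * (s0\<^sup>2 / (576 * real n))" using r_sq pos by (intro mult_left_mono) auto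
        also have "\<dots> \<le> e2 * s0\<^sup>2 / real n" using pos n1 by (simp add: field_simps)
        finally show ?thesis .
      qed
      have "0 \<le> e2 * s0\<^sup>2" using pos by simp
      then show "e2 * s0\<^sup>2 / real n \<le> 1" using n by (subst pos_divide_le_eq) auto
      show "B t \<subseteq> {1..n} - {i}" if "t < 5" for t
      proof -
        have "(t + 1) * l \<le> 5 * l" using that by (intro mult_right_mono) auto
        then have "(t + 1) * l \<le> n" using l(1) by (rule order_trans)
        then have "{t * l + 1..(t + 1) * l} \<subseteq> {1..n}" unfolding atLeastatMost_subset_iff by auto
        then show ?thesis unfolding B_def by blast
      qed
      show "disjoint_family_on B {..<5}"
        unfolding disjoint_family_on_def
      proof (intro ballI impI)
        have lt: "B t \<inter> B t' = {}" if "t < t'" for t t'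
        proof -
          have "(t + 1) * l \<le> t' * l" using that by (intro mult_right_mono) auto
          then show ?thesis unfolding B_def by auto
        qed
        fix t t' :: nat assume "t \<noteq> t'"
        then show "B t \<inter> B t' = {}" using lt[of t t'] lt[of t' t] by (cases "t < t'") auto
      qed
      show "l - 1 \<le> card (B t)" for t
      proof -
        have "card {t * l + 1..(t + 1) * l} = l" by simp
        then show ?thesis unfolding B_def using diff_card_le_card_Diff[of "{i}" "{t * l + 1..(t + 1) * l}"] by simp
      qed
      show "b0 / real n \<le> measure \<mu> (shield r (ctr z) t)" if "t < 5" for t
        by (rule small[OF z shield_subset_cell[OF r0 that]])
      show "0 \<le> b0 / real n" using b0_pos by simp
    qed (use z sets_cell sets_shield shield_in_cell P\<mu> in auto)
    also have "{x\<in>space (sample ({1..n} - {i})).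
          (\<forall>k\<in>{1..n} - {i}. x k \<in> cell r (ctr z) \<longrightarrow> (\<exists>t<5. x k \<in> shield r (ctr z) t)) \<and>
          (\<forall>t<5. \<exists>k\<in>{1..n} - {i}. x k \<in> shield r (ctr z) t)} =
        {x\<in>space (sample ({1..n} - {i})). shielded ({1..n} - {i}) z x}"
      unfolding shielded_def ..
    finally have occ: "(real (l - 1) * (b0 / real n)) ^ 5 * (1 - e2 * s0\<^sup>2 / real n) ^ card ({1..n} - {i}) \<le>
        measure (sample ({1..n} - {i})) {x\<in>space (sample ({1..n} - {i})). shielded ({1..n} - {i}) z x}" .
    have "b0 / 10 = real n / 10 * (b0 / real n)" using n1 by simp
    also have "\<dots> \<le> real (l - 1) * (b0 / real n)" using l(2) b0_pos by (intro mult_right_mono) auto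
    finally have five: "(b0 / 10) ^ 5 \<le> (real (l - 1) * (b0 / real n)) ^ 5" by (rule power_mono) (use b0_pos in simp)
    have "card ({1..n} - {i}) \<le> n" using card_mono[of "{1..n}" "{1..n} - {i}"] by simp
    then have ex: "exp (- 2 * (e2 * s0\<^sup>2)) \<le> (1 - e2 * s0\<^sup>2 / real n) ^ card ({1..n} - {i})"
      using pos n n1 by (intro exp_le_one_minus_power) auto
    have "\<rho> \<le> (real (l - 1) * (b0 / real n)) ^ 5 * (1 - e2 * s0\<^sup>2 / real n) ^ card ({1..n} - {i})"
      unfolding \<rho> by (rule mult_mono[OF five ex]) (use b0_pos in simp_all)
    then show "\<rho> \<le> measure (sample ({1..n} - {i})) {x\<in>space (sample ({1..n} - {i})). shielded ({1..n} - {i}) z x}"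
      using occ by linarith
  qed
  have r_pow: "(s0 / 48) powr \<alpha> * real n powr (- \<alpha> / 2) \<le> r powr \<alpha>"
  proof -
    have "s0 / 48 * real n powr (- 1 / 2) = s0 / (48 * sqrt (real n))"
      using n1 by (simp add: powr_minus_divide powr_half_sqrt)
    also have "\<dots> \<le> r" unfolding r_def using k n1 pos by (intro divide_left_mono mult_left_mono mult_pos_pos) auto
    finally have "(s0 / 48 * real n powr (- 1 / 2)) powr \<alpha> \<le> r powr \<alpha>" using pos by (intro powr_mono2) auto
    moreover have "(s0 / 48 * real n powr (- 1 / 2)) powr \<alpha> = (s0 / 48) powr \<alpha> * (real n powr (- 1 / 2)) powr \<alpha>"
      by (rule powr_mult)
    moreover have "(real n powr (- 1 / 2)) powr \<alpha> = real n powr (- \<alpha> / 2)" by (simp add: powr_powr)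
    ultimately show ?thesis by (simp only:)
  qed
  have "q * real n powr (- \<alpha> / 2) = b0 / 4 * \<delta> * \<rho> * ((s0 / 48) powr \<alpha> * real n powr (- \<alpha> / 2))"
    by (simp add: q \<delta>_def)
  also have "\<dots> \<le> b0 / 4 * \<delta> * \<rho> * r powr \<alpha>" using r_pow b0_pos \<delta> \<rho>0 by (intro mult_left_mono) auto
  also have "\<dots> = real n / 4 * (b0 / real n * \<Delta> * \<rho>)" using n1 by (simp add: \<Delta>)
  also have "\<dots> \<le> real k * real k * (b0 / real n * \<Delta> * \<rho>)"
    using k(3) b0_pos \<Delta> \<delta> \<rho>0 by (intro mult_right_mono) auto
  finally have main: "q * real n powr (- \<alpha> / 2) \<le> real k * real k * (b0 / real n * \<Delta> * \<rho>)" .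
  have q0: "0 \<le> q" unfolding q \<delta>_def[symmetric] using b0_pos \<delta> \<rho>0 by simp
  have "q\<^sup>2 / (e2 / e1)\<^sup>2 * real n powr (1 - \<alpha>) = (real n * (q * real n powr (- \<alpha> / 2)))\<^sup>2 / (real n * (e2 / e1)\<^sup>2)"
  proof -
    have "(real n powr (- \<alpha> / 2))\<^sup>2 = real n powr (- \<alpha>)" by (simp add: power2_eq_square flip: powr_add)
    moreover have "real n powr (1 - \<alpha>) = real n * real n powr (- \<alpha>)" using n1 by (simp add: powr_diff powr_minus_divide)
    ultimately show ?thesis using n1 by (simp add: power_mult_distrib power2_eq_square)
  qed
  also have "\<dots> \<le> (real n * (real k * real k * (b0 / real n * \<Delta> * \<rho>)))\<^sup>2 / (real n * (e2 / e1)\<^sup>2)"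
    using main q0 by (intro divide_right_mono power_mono mult_left_mono) auto
  also have "\<dots> \<le> prob_space.variance (sample {1..n}) (MST h \<alpha> n)" using ge by (simp add: card_cartesian_product)
  finally show ?thesis unfolding var .
qed

theorem theorem6:
  fixes \<alpha> c\<^sub>1 c\<^sub>2 \<epsilon>\<^sub>1 \<epsilon>\<^sub>2 s\<^sub>0 :: real
  assumes "0 < \<alpha>" and "0 < c\<^sub>1" and "0 < c\<^sub>2"
    and "0 < \<epsilon>\<^sub>1" and "\<epsilon>\<^sub>1 \<le> \<epsilon>\<^sub>2" and "0 < s\<^sub>0"
  shows "\<exists>D\<^sub>2>0. \<forall>(M :: 'a measure) (X :: nat \<Rightarrow> 'a \<Rightarrow> real^2)
            (f :: real^2 \<Rightarrow> real) (h :: real^2 \<Rightarrow> real^2 \<Rightarrow> real) (S\<^sub>0 :: (real^2) set).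
           prob_space M \<longrightarrow>
           prob_space.iid_density M f X \<longrightarrow>
           (\<forall>x\<in>unit_square. \<epsilon>\<^sub>1 \<le> f x \<and> f x \<le> \<epsilon>\<^sub>2) \<longrightarrow>
           admissible_weight c\<^sub>1 c\<^sub>2 h \<longrightarrow>
           is_square S\<^sub>0 s\<^sub>0 \<longrightarrow> S\<^sub>0 \<subseteq> unit_square \<longrightarrow>
           (\<forall>u\<in>unit_square. \<forall>v\<in>unit_square. u \<in> S\<^sub>0 \<or> v \<in> S\<^sub>0 \<longrightarrow> h u v = dist u v) \<longrightarrow>
           (\<forall>\<^sub>F n in sequentially.
              prob_space.variance M (\<lambda>\<omega>. MST h \<alpha> n (\<lambda>i. X i \<omega>)) \<ge> D\<^sub>2 * real n powr (1 - \<alpha>))"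
proof -
  define b0 where "b0 = \<epsilon>\<^sub>1 * s\<^sub>0\<^sup>2 / 5760000"
  define \<rho> where "\<rho> = (b0 / 10) ^ 5 * exp (- 2 * (\<epsilon>\<^sub>2 * s\<^sub>0\<^sup>2))"
  define q where "q = b0 / 4 * ((19/10) powr \<alpha> - (11/10) powr \<alpha>) * (s\<^sub>0 / 48) powr \<alpha> * \<rho>"
  have "(11/10 :: real) powr \<alpha> < (19/10) powr \<alpha>" using assms(1) by (intro powr_less_mono2) auto
  moreover have "0 < b0" using assms by (simp add: b0_def)
  ultimately have "0 < q" using assms by (simp add: q_def \<rho>_def)
  then have "0 < q\<^sup>2 / (\<epsilon>\<^sub>2 / \<epsilon>\<^sub>1)\<^sup>2" using assms by simp
  moreover have "\<forall>\<^sub>F n in sequentially. 20 \<le> n \<and> 2 * (\<epsilon>\<^sub>2 * s\<^sub>0\<^sup>2) \<le> real n"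
    by (intro eventually_conj eventually_ge_at_top)
       (rule filterlim_at_top[THEN iffD1, OF filterlim_real_sequentially, rule_format])
  then have "\<forall>\<^sub>F n in sequentially.
      q\<^sup>2 / (\<epsilon>\<^sub>2 / \<epsilon>\<^sub>1)\<^sup>2 * real n powr (1 - \<alpha>) \<le> prob_space.variance M (\<lambda>\<omega>. MST h \<alpha> n (\<lambda>i. X i \<omega>))"
    if "prob_space M" "prob_space.iid_density M f X" "\<forall>x\<in>unit_square. \<epsilon>\<^sub>1 \<le> f x \<and> f x \<le> \<epsilon>\<^sub>2"
      "admissible_weight c\<^sub>1 c\<^sub>2 h" "is_square S\<^sub>0 s\<^sub>0" "S\<^sub>0 \<subseteq> unit_square"
      "\<forall>u\<in>unit_square. \<forall>v\<in>unit_square. u \<in> S\<^sub>0 \<or> v \<in> S\<^sub>0 \<longrightarrow> h u v = dist u v"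
    for M :: "'a measure" and X f h S\<^sub>0
  proof eventually_elim
    case (elim n)
    show ?case
      by (rule variance_MST_ge[where f = f and S = S\<^sub>0, OF assms(1,3-6) that(1,2) _ that(4-6)
            _ _ _ b0_def \<rho>_def q_def]) (use that elim in auto)
  qed
  ultimately show ?thesis by blast
qed

end
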